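(* Let $K$ be a number field and let $F$ be a finite extension of $K^{tr}$. Then there is an effective positive constant $c_F$ such that $h(\alpha)\geq c_F$ for all $\alpha\in F^*$ with at least one $K$-conjugate not on the unit circle, i.e. for all $\alpha\in F^*$ such that $|\sigma(\alpha)|\neq 1$ for some $\sigma\in \mathrm{Gal}(\overline{\mathbb{Q}}/K)$.
   Context: All algebraic extensions of $\mathbb{Q}$ are taken inside a fixed algebraic closure $\overline{\mathbb{Q}}\subseteq\mathbb{C}$. $h$ denotes the absolute logarithmic Weil height on $\overline{\mathbb{Q}}$. For a number field $K$, $K^{tr}=\{\alpha\in\overline{\mathbb{Q}} : \sigma(\alpha)\in\mathbb{R} \text{ for all } \sigma\in\mathrm{Gal}(\overline{\mathbb{Q}}/K)\}$. *)

theory Defs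
  imports
    "HOL-Algebra.Algebraic_Closure_Type"
    "HOL-Algebra.Embedded_Algebras"
    "HOL-Algebra.Generated_Fields"
    "HOL-Library.Nat_Bijection"
    "Berlekamp_Zassenhaus.Mahler_Measure"
begin

section \<open>Fields of algebraic numbers\<close>

abbreviation CC :: "complex ring" where
  "CC \<equiv> ring_of_type_algebra"

definition Qbar :: "complex set" where
  "Qbar = {z. algebraic z}"

definition number_field :: "complex set \<Rightarrow> bool" where
  "number_field K \<longleftrightarrow> subfield K CC \<and> ring.finite_dimension CC \<rat> K"

definition finite_field_ext :: "complex set \<Rightarrow> complex set \<Rightarrow> bool" where
  "finite_field_ext E F \<longleftrightarrow>
     subfield E CC \<and> subfield F CC \<and> E \<subseteq> F \<and> ring.finite_dimension CC E F"

text \<open>Elements of the Galois group are functions on all of the complex numbers of which only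
  the restriction to \<^term>\<open>Qbar\<close> is constrained; the values elsewhere are irrelevant.\<close>

definition Gal_Qbar :: "complex set \<Rightarrow> (complex \<Rightarrow> complex) set" where
  "Gal_Qbar K =
     {\<sigma> \<in> ring_iso (CC\<lparr>carrier := Qbar\<rparr>) (CC\<lparr>carrier := Qbar\<rparr>). \<forall>x\<in>K. \<sigma> x = x}"

definition tot_real :: "complex set \<Rightarrow> complex set" where
  "tot_real K = {\<alpha> \<in> Qbar. \<forall>\<sigma> \<in> Gal_Qbar K. \<sigma> \<alpha> \<in> \<real>}"


section \<open>The absolute logarithmic Weil height\<close>

text \<open>The minimal polynomial over the integers: irreducible in \<open>\<int>[X]\<close>, hence primitive, and
  with positive leading coefficient. It is unique for every algebraic number.\<close>

definition min_int_poly :: "complex \<Rightarrow> int poly" where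
  "min_int_poly \<alpha> = (THE p. Factorial_Ring.irreducible p \<and> lead_coeff p > 0 \<and>
                            poly (map_poly of_int p) \<alpha> = 0)"

text \<open>If the minimal polynomial is \<open>a (X - \<alpha>\<^sub>1) \<dots> (X - \<alpha>\<^sub>d)\<close>, this is
  \<open>(1/d) (log \<bar>a\<bar> + \<Sum>\<^sub>i log (max 1 \<bar>\<alpha>\<^sub>i\<bar>))\<close>.\<close>

definition weil_height :: "complex \<Rightarrow> real" where
  "weil_height \<alpha> =
     ln (mahler_measure (min_int_poly \<alpha>)) / real (degree (min_int_poly \<alpha>))"


section \<open>Effectivity\<close>

text \<open>The total recursive functions of arity \<open>n\<close>, acting on lists of length \<open>n\<close>
  (the values on lists of other lengths carry no meaning). Minimisation is only applied to regular
  functions, which by Kleene's normal form theorem yields all total computable functions.\<close>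

inductive total_recursive :: "nat \<Rightarrow> (nat list \<Rightarrow> nat) \<Rightarrow> bool" where
  zero: "total_recursive n (\<lambda>_. 0)"
| succ: "total_recursive 1 (\<lambda>xs. Suc (xs ! 0))"
| proj: "i < n \<Longrightarrow> total_recursive n (\<lambda>xs. xs ! i)"
| comp: "\<lbrakk>total_recursive (length fs) g; \<forall>f\<in>set fs. total_recursive n f\<rbrakk>
         \<Longrightarrow> total_recursive n (\<lambda>xs. g (map (\<lambda>f. f xs) fs))"
| prec: "\<lbrakk>total_recursive n g; total_recursive (Suc (Suc n)) h\<rbrakk>
         \<Longrightarrow> total_recursive (Suc n)
               (\<lambda>xs. rec_nat (g (tl xs)) (\<lambda>k r. h (k # r # tl xs)) (hd xs))"
| minim: "\<lbrakk>total_recursive (Suc n) g; \<forall>xs. length xs = n \<longrightarrow> (\<exists>k. g (k # xs) = 0)\<rbrakk>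
         \<Longrightarrow> total_recursive n (\<lambda>xs. LEAST k. g (k # xs) = 0)"

text \<open>\<open>K = \<rat>(\<gamma>\<^sub>1, \<dots>, \<gamma>\<^sub>r)\<close> and \<open>F = K\<^sup>t\<^sup>r(\<beta>\<^sub>1, \<dots>, \<beta>\<^sub>s)\<close>, with the generators given as roots of
  nonzero integer polynomials. Every number field \<open>K\<close> and finite extension \<open>F\<close> of \<open>K\<^sup>t\<^sup>r\<close> arise in
  this way. The polynomials fix the generators up to finitely many choices; singling out the roots
  by further data would give the same notion of effectivity below, since one can minimise over the
  choices.\<close>

definition presents ::
    "int poly list \<Rightarrow> int poly list \<Rightarrow> complex set \<Rightarrow> complex set \<Rightarrow> bool" where
  "presents ps qs K F \<longleftrightarrow>
     (\<exists>\<gamma>s \<beta>s.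
        list_all2 (\<lambda>p \<gamma>. p \<noteq> 0 \<and> poly (map_poly of_int p) \<gamma> = 0) ps \<gamma>s \<and>
        list_all2 (\<lambda>q \<beta>. q \<noteq> 0 \<and> poly (map_poly of_int q) \<beta> = 0) qs \<beta>s \<and>
        K = generate_field CC (set \<gamma>s) \<and>
        F = generate_field CC (tot_real K \<union> set \<beta>s))"

definition polys_code :: "int poly list \<Rightarrow> nat" where
  "polys_code ps = list_encode (map (\<lambda>p. list_encode (map int_encode (coeffs p))) ps)"

text \<open>A positive constant depending on \<open>K\<close> and \<open>F\<close> which is used as a lower bound is effective if
  some algorithm computes, from a presentation of \<open>K\<close> and \<open>F\<close>, a positive rational number that it
  is at least as large as.\<close>

definition effective_constant :: "(complex set \<Rightarrow> complex set \<Rightarrow> real) \<Rightarrow> bool" where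
  "effective_constant c \<longleftrightarrow>
     (\<exists>N. total_recursive 2 N \<and>
        (\<forall>ps qs K F. presents ps qs K F \<longrightarrow>
           c K F \<ge> 1 / real (Suc (N [polys_code ps, polys_code qs]))))"

end

theory Submission
  imports Defs "Jordan_Normal_Form.Char_Poly"
begin

text \<open>Let \<open>S\<close> be the set of all roots of the polynomials presenting \<open>K\<close> and \<open>F\<close>, let
  \<open>|\<sigma>\<^sub>0(\<alpha>)| \<noteq> 1\<close>, and put \<open>\<tau> = \<sigma>\<^sub>0\<^sup>-\<^sup>1 \<circ> cnj \<circ> \<sigma>\<^sub>0\<close>. Every automorphism \<open>\<sigma>\<close> that agrees
  with \<open>\<sigma>\<^sub>0\<close> on \<open>S\<close> satisfies \<open>cnj \<circ> \<sigma> = \<sigma> \<circ> \<tau>\<close> on \<open>S\<close> and on \<open>K\<^sup>t\<^sup>r\<close>, hence on \<open>F\<close>. So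
  \<open>\<sigma>(\<alpha> \<tau>(\<alpha>)) = |\<sigma>(\<alpha>)|\<^sup>2\<close> is a positive real for at least the fraction \<open>1 / m\<close> of all \<open>\<sigma>\<close>, where
  \<open>m = |S|!\<close>, whereas \<open>\<alpha> \<tau>(\<alpha>) \<noteq> 1\<close>. If the height of \<open>\<alpha>\<close> were tiny, almost all conjugates of
  \<open>\<alpha>\<close> would lie near the unit circle, so these positive numbers would lie near 1 and make the
  norm of \<open>\<alpha> \<tau>(\<alpha>) - 1\<close> small. After multiplication by a power of the leading coefficient of the
  minimal polynomial of \<open>\<alpha>\<close> this norm is a nonzero integer, which gives a lower bound for the
  height in terms of \<open>m\<close> alone.\<close>


section \<open>Algebraic integers\<close>

text \<open>On \<open>tot_real K\<close> complex conjugation commutes with the automorphisms over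
  \<open>K\<close>, but in general not on \<open>F\<close>; this is the obstacle. The choice of
  \<tau> makes \<open>cnj \<circ> \<sigma>\<^sub>0 = \<sigma>\<^sub>0 \<circ> \<tau>\<close> hold on
  all of \<open>Qbar\<close>. The identity passes to \<sigma> because \<sigma> fixes the generators
  of \<open>K\<close>, so that both sides equal \<sigma> on \<open>tot_real K\<close>, and because
  \<open>S\<close> is stable under \<tau>. As \<tau>(\<alpha>) is conjugate to \<alpha> over the
  rationals, it has the same minimal polynomial, so the estimate involves one height and one leading
  coefficient only, whatever field contains \<alpha> \<tau>(\<alpha>). The trivial estimate of the
  logarithm of |\<sigma>(\<alpha> \<tau>(\<alpha>)) - 1| costs \<open>ln 2\<close> per automorphism.
  A free parameter in the estimate near the unit circle, set to \<open>4 ^ m\<close>, gains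
  \<open>2 * m * ln 2\<close> for each good automorphism, hence at least \<open>2 * ln 2\<close> on
  average. What remains is \<open>ln 2 \<le> (2 + 4 * 4 ^ m) * h\<close> with \<open>h\<close> the
  height of \<alpha>. Effectivity then only requires a bound for |S|, and the degrees of the
  presenting polynomials provide it.\<close>

inductive_set zspan :: "complex set \<Rightarrow> complex set" for B where
  zero: "0 \<in> zspan B"
| incl: "b \<in> B \<Longrightarrow> b \<in> zspan B"
| diff: "x \<in> zspan B \<Longrightarrow> y \<in> zspan B \<Longrightarrow> x - y \<in> zspan B"

lemma zspan_uminus: "x \<in> zspan B \<Longrightarrow> - x \<in> zspan B"
  using zspan.diff[OF zspan.zero] by fastforce

lemma zspan_add: "x \<in> zspan B \<Longrightarrow> y \<in> zspan B \<Longrightarrow> x + y \<in> zspan B"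
  using zspan.diff[OF _ zspan_uminus] by fastforce

lemma zspan_sum: "(\<And>i. i \<in> I \<Longrightarrow> f i \<in> zspan B) \<Longrightarrow> sum f I \<in> zspan B"
  by (induction I rule: infinite_finite_induct) (auto intro: zspan.zero zspan_add)

lemma zspan_int_mult: "x \<in> zspan B \<Longrightarrow> of_int n * x \<in> zspan B"
proof (induction n rule: int_induct[where k = 0])
  case base
  then show ?case by (simp add: zspan.zero)
next
  case (step1 i)
  then show ?case by (simp add: algebra_simps zspan_add)
next
  case (step2 i)
  then show ?case by (simp add: algebra_simps zspan.diff)
qed

lemma zspan_mult_closed:
  assumes "\<And>b. b \<in> B \<Longrightarrow> x * b \<in> zspan C" "y \<in> zspan B"
  shows "x * y \<in> zspan C"
  using assms(2)
  by induction (simp_all add: right_diff_distrib assms(1) zspan.zero zspan.diff)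

lemma zspan_finite:
  assumes "finite B" "x \<in> zspan B"
  shows "\<exists>c. x = (\<Sum>b\<in>B. of_int (c b) * b)"
  using assms(2)
proof induction
  case zero
  show ?case by (rule exI[of _ "\<lambda>_. 0"]) simp
next
  case (incl b)
  have "b = (\<Sum>a\<in>B. of_int (if a = b then 1 else 0) * a)"
    using assms(1) incl by (simp add: if_distrib[of of_int] if_distrib[of "\<lambda>x. x * _"] sum.delta cong: if_cong)
  then show ?case by (rule exI[of _ "\<lambda>a. if a = b then 1 else 0"])
next
  case (diff x y)
  then obtain c d where "x = (\<Sum>b\<in>B. of_int (c b) * b)" "y = (\<Sum>b\<in>B. of_int (d b) * b)"
    by blast
  then have "x - y = (\<Sum>b\<in>B. of_int (c b - d b) * b)"
    by (simp add: algebra_simps sum_subtractf)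
  then show ?case by (rule exI[of _ "\<lambda>b. c b - d b"])
qed

text \<open>Multiplication by \<open>z\<close> on the generators is given by an integer matrix, which has \<open>z\<close> as an
  eigenvalue.\<close>

lemma algebraic_int_if_stable:
  fixes z :: complex
  assumes fin: "finite B" and nz: "\<exists>b\<in>B. b \<noteq> 0"
    and st: "\<And>b. b \<in> B \<Longrightarrow> z * b \<in> zspan B"
  shows "algebraic_int z"
proof -
  obtain c where c: "\<And>b. b \<in> B \<Longrightarrow> z * b = (\<Sum>a\<in>B. of_int (c b a) * a)"
    using zspan_finite[OF fin st] by metis
  define n where "n = card B"
  obtain e where e: "bij_betw e {0..<n} B"
    using ex_bij_betw_nat_finite[OF fin] n_def by blast
  define M where "M = mat n n (\<lambda>(i, j). c (e i) (e j))"
  define MC where "MC = (of_int_hom.mat_hom M :: complex mat)"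
  define v where "v = vec n e"
  have M: "M \<in> carrier_mat n n" and MC: "MC \<in> carrier_mat n n"
    by (auto simp: M_def MC_def)
  have eB: "e i \<in> B" if "i < n" for i
    using e that by (auto simp: bij_betw_def)
  have "MC *\<^sub>v v = z \<cdot>\<^sub>v v"
  proof (rule eq_vecI)
    fix i assume "i < dim_vec (z \<cdot>\<^sub>v v)"
    then have i: "i < n" by (simp add: v_def)
    have "(MC *\<^sub>v v) $ i = (\<Sum>j\<in>{0..<n}. of_int (c (e i) (e j)) * e j)"
      using i by (simp add: MC_def M_def v_def scalar_prod_def)
    also have "\<dots> = (\<Sum>a\<in>B. of_int (c (e i) a) * a)"
      by (rule sum.reindex_bij_betw[OF e])
    also have "\<dots> = z * e i" using c[OF eB[OF i]] by simp
    finally show "(MC *\<^sub>v v) $ i = (z \<cdot>\<^sub>v v) $ i" using i by (simp add: v_def)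
  qed (simp add: v_def MC_def M_def)
  moreover have "v \<noteq> 0\<^sub>v n"
  proof
    assume v0: "v = 0\<^sub>v n"
    obtain b i where "b \<in> B" "b \<noteq> 0" "i < n" "e i = b"
      using nz e by (force simp: bij_betw_def)
    then show False using arg_cong[OF v0, of "\<lambda>w. vec_index w i"] by (simp add: v_def)
  qed
  ultimately have "eigenvalue MC z"
    unfolding eigenvalue_def eigenvector_def using MC by (intro exI[of _ v]) (auto simp: v_def)
  then have "poly (char_poly MC) z = 0"
    using eigenvalue_root_char_poly[OF MC] by blast
  moreover have "char_poly MC = map_poly of_int (char_poly M)"
    unfolding MC_def by (rule of_int_hom.char_poly_hom[OF M])
  ultimately show ?thesis
    unfolding algebraic_int_altdef_ipoly using degree_monic_char_poly[OF M]
    by (intro exI[of _ "char_poly M"]) auto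
qed

lemma poly_eq_sum_monic:
  assumes "lead_coeff p = (1::complex)" "poly p z = 0"
  shows "z ^ degree p = (\<Sum>i<degree p. - coeff p i * z ^ i)"
proof -
  have "0 = (\<Sum>i<degree p. coeff p i * z ^ i) + z ^ degree p"
    using assms by (simp add: poly_altdef lessThan_Suc_atMost[symmetric])
  then show ?thesis by (simp add: sum_negf eq_neg_iff_add_eq_0 add.commute)
qed

text \<open>The products \<open>b * z ^ i\<close> with \<open>i < degree p\<close> generate a module
  stable under \<open>z\<close>, because the monic equation rewrites the top power. The set
  \<open>S\<close> is carried along so that algebraic integers can be adjoined one after the other,
  and \<open>1 \<in> C\<close> keeps the module nonzero.\<close>

lemma stable_module_root:
  assumes "lead_coeff p = (1::complex)" "poly p z = 0"
    and fin: "finite B" and B1: "1 \<in> B"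
    and st: "\<And>b i. b \<in> B \<Longrightarrow> coeff p i * b \<in> zspan B"
    and xst: "\<And>b x. b \<in> B \<Longrightarrow> x \<in> S \<Longrightarrow> x * b \<in> zspan B"
  shows "\<exists>C. finite C \<and> 1 \<in> C \<and> (\<forall>x\<in>insert z S. \<forall>c\<in>C. x * c \<in> zspan C)"
proof -
  define n where "n = degree p"
  have n: "n > 0"
    using assms(1,2) unfolding n_def
    by (metis degree_0_id gr0I one_neq_zero poly_const_conv)
  define C where "C = (\<lambda>(b, i). b * z ^ i) ` (B \<times> {..<n})"
  have finC: "finite C" using fin by (simp add: C_def)
  have Cpow: "y * z ^ i \<in> zspan C" if "y \<in> zspan B" "i < n" for y i
  proof -
    have "z ^ i * b \<in> zspan C" if "b \<in> B" for b
      using that \<open>i < n\<close> by (intro zspan.incl) (auto simp: C_def image_iff mult.commute)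
    from zspan_mult_closed[OF this that(1)] show ?thesis by (simp add: mult.commute)
  qed
  have "1 * z ^ 0 \<in> C"
    unfolding C_def using B1 n by (intro image_eqI[of _ _ "(1, 0)"]) auto
  then have "1 \<in> C" by simp
  moreover have "z * c \<in> zspan C" if c: "c \<in> C" for c
  proof -
    obtain b i where bi: "b \<in> B" "i < n" "c = b * z ^ i"
      using c by (auto simp: C_def)
    show ?thesis
    proof (cases "Suc i < n")
      case True
      then show ?thesis using bi Cpow[of b "Suc i"]
        by (simp add: algebra_simps zspan.incl)
    next
      case False
      then have "Suc i = n" using bi by simp
      then have "z * c = b * z ^ n" using bi by auto
      also have "\<dots> = (\<Sum>i<n. - (coeff p i * b) * z ^ i)"
        unfolding n_def poly_eq_sum_monic[OF assms(1,2)]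
        by (simp add: sum_distrib_left algebra_simps)
      also have "\<dots> \<in> zspan C"
        by (intro zspan_sum Cpow zspan_uminus st bi) auto
      finally show ?thesis .
    qed
  qed
  moreover have "x * c \<in> zspan C" if c: "c \<in> C" and x: "x \<in> S" for x c
  proof -
    obtain b i where bi: "b \<in> B" "i < n" "c = b * z ^ i"
      using c by (auto simp: C_def)
    then show ?thesis using Cpow[OF xst[OF bi(1) x] bi(2)] by (simp add: mult.assoc)
  qed
  ultimately show ?thesis using finC by blast
qed

lemma stable_module_algebraic_ints:
  assumes "finite S" "\<And>x. x \<in> S \<Longrightarrow> algebraic_int (x::complex)"
  shows "\<exists>B. finite B \<and> 1 \<in> B \<and> (\<forall>x\<in>S. \<forall>b\<in>B. x * b \<in> zspan B)"
  using assms
proof (induction S rule: finite_induct)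
  case empty
  show ?case by (intro exI[of _ "{1}"]) auto
next
  case (insert z S)
  then obtain B where B: "finite B" "1 \<in> B" "\<forall>x\<in>S. \<forall>b\<in>B. x * b \<in> zspan B"
    by auto
  from insert.prems[of z] obtain p where p: "poly (map_poly of_int p) z = 0" "lead_coeff p = 1"
    unfolding algebraic_int_altdef_ipoly by auto
  show ?case
    by (rule stable_module_root[of "map_poly of_int p" z B S])
       (use B p in \<open>auto intro: zspan_int_mult zspan.incl\<close>)
qed

text \<open>The finitely many coefficients stabilise a common finitely generated module, and
  adjoining the powers of \<open>z\<close> gives one that is stable under \<open>z\<close> as
  well.\<close>

lemma algebraic_int_root_monic:
  assumes "lead_coeff p = (1::complex)" "poly p z = 0" "\<And>i. algebraic_int (coeff p i)"
  shows "algebraic_int z"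
proof -
  have "finite (range (coeff p))"
    by (rule finite_subset[of _ "insert 0 (coeff p ` {..degree p})"])
       (auto, metis atMost_iff coeff_eq_0 image_eqI not_le)
  then obtain B where B: "finite B" "1 \<in> B" "\<forall>x\<in>range (coeff p). \<forall>b\<in>B. x * b \<in> zspan B"
    using stable_module_algebraic_ints[of "range (coeff p)"] assms(3) by auto
  then obtain C where "finite C" "1 \<in> C" "\<forall>c\<in>C. z * c \<in> zspan C"
    using stable_module_root[OF assms(1,2) B(1,2), of "{}"] by auto
  then show ?thesis using algebraic_int_if_stable[of C z] by force
qed

text \<open>A module stable under both \<open>x\<close> and \<open>y\<close> is stable under their
  product and difference.\<close>

lemma algebraic_int_mult_diff:
  fixes x y :: complex
  assumes "algebraic_int x" "algebraic_int y"
  shows "algebraic_int (x * y)" "algebraic_int (x - y)"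
proof -
  obtain B where B: "finite B" "1 \<in> B" "\<forall>u\<in>{x, y}. \<forall>b\<in>B. u * b \<in> zspan B"
    using stable_module_algebraic_ints[of "{x, y}"] assms by auto
  then have "x * y * b \<in> zspan B" "(x - y) * b \<in> zspan B" if "b \<in> B" for b
    using zspan_mult_closed[of B x B "y * b"] that
    by (auto simp: algebra_simps zspan.diff)
  then show "algebraic_int (x * y)" "algebraic_int (x - y)"
    using algebraic_int_if_stable[of B] B by force+
qed

lemmas algebraic_int_mult = algebraic_int_mult_diff(1)
lemmas algebraic_int_diff = algebraic_int_mult_diff(2)

lemma algebraic_int_add: "algebraic_int x \<Longrightarrow> algebraic_int y \<Longrightarrow> algebraic_int (x + y :: complex)"
  using algebraic_int_diff[of x "- y"] by simp

lemma algebraic_int_one: "algebraic_int (1::complex)"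
  by (rule int_imp_algebraic_int) simp

lemma algebraic_int_prod: "(\<And>i. i \<in> I \<Longrightarrow> algebraic_int (f i :: complex)) \<Longrightarrow> algebraic_int (prod f I)"
  by (induction I rule: infinite_finite_induct) (auto intro: algebraic_int_mult algebraic_int_one)

lemma algebraic_int_sum: "(\<And>i. i \<in> I \<Longrightarrow> algebraic_int (f i :: complex)) \<Longrightarrow> algebraic_int (sum f I)"
  by (induction I rule: infinite_finite_induct) (auto intro: algebraic_int_add)

lemma algebraic_int_power: "algebraic_int (x::complex) \<Longrightarrow> algebraic_int (x ^ n)"
  by (induction n) (auto intro: algebraic_int_mult algebraic_int_one)

section \<open>Integrality of the leading coefficient times products of roots\<close>

lemma algebraic_int_lead_coeff_mult_root:
  fixes p :: "complex poly"
  assumes "\<And>i. algebraic_int (coeff p i)" "poly p z = 0"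
  shows "algebraic_int (lead_coeff p * z)"
proof (cases "degree p = 0")
  case True
  then obtain c where "p = [:c:]" by (elim degree_eq_zeroE)
  then have "p = 0" using assms(2) by simp
  then show ?thesis by simp
next
  case False
  define a n where "a = lead_coeff p" and "n = degree p"
  have n: "n > 0" and a: "a \<noteq> 0" using False by (auto simp: n_def a_def)
  \<comment> \<open>This is the monic polynomial with \<open>q(a X) = a ^ (n - 1) * p(X)\<close>.
    The exponent is \<open>n - 1\<close> because the leading term of \<open>p\<close> contributes
    one further factor \<open>a\<close>.\<close>
  define q where "q = monom 1 n + (\<Sum>i<n. monom (coeff p i * a ^ (n - 1 - i)) i)"
  have cq: "coeff q i = (if i = n then 1 else if i < n then coeff p i * a ^ (n - 1 - i) else 0)" for i
  proof -
    have "coeff (\<Sum>k<n. monom (coeff p k * a ^ (n - 1 - k)) k) i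
        = (\<Sum>k<n. if k = i then coeff p k * a ^ (n - 1 - k) else 0)"
      by (simp add: coeff_sum)
    then show ?thesis by (simp add: q_def sum.delta)
  qed
  have dq: "degree q = n"
    by (rule antisym) (auto intro!: degree_le le_degree simp: cq)
  have "poly q (a * z) = a ^ (n - 1) * poly p z"
  proof -
    have "poly p z = (\<Sum>i<n. coeff p i * z ^ i) + a * z ^ n"
      by (simp add: poly_altdef lessThan_Suc_atMost[symmetric] n_def a_def)
    moreover have "a ^ (n - 1) * (a * z ^ n) = (a * z) ^ n"
      using n by (cases n) (simp_all add: power_mult_distrib)
    moreover have "a ^ (n - 1 - i) * (a * z) ^ i = a ^ (n - 1) * z ^ i" if "i < n" for i
      using that by (simp add: power_mult_distrib mult.assoc[symmetric] power_add[symmetric])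
    ultimately show ?thesis
      by (simp add: q_def poly_sum poly_monom sum_distrib_left distrib_left mult.assoc mult.left_commute)
  qed
  then have "poly q (a * z) = 0" using assms(2) by simp
  moreover have "lead_coeff q = 1" by (simp add: dq cq)
  moreover have "algebraic_int (coeff q i)" for i
  proof -
    have "algebraic_int (coeff p i * a ^ (n - 1 - i))"
      unfolding a_def by (intro algebraic_int_mult algebraic_int_power assms(1))
    then show ?thesis by (simp add: cq algebraic_int_one)
  qed
  ultimately have "algebraic_int (a * z)"
    using algebraic_int_root_monic[of q "a * z"] by blast
  then show ?thesis by (simp only: a_def)
qed

text \<open>The polynomial \<open>[:-z, 1:] * q\<close> has the root \<open>z\<close> and the
  leading coefficient \<open>a\<close> of \<open>q\<close>, so \<open>a\<close> and
  \<open>a * z\<close> are algebraic integers. Removing the leading term of \<open>q\<close> changes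
  the product only by these two coefficients, and the induction applies to the rest.\<close>

lemma algebraic_int_coeff_div_linear:
  fixes q :: "complex poly"
  assumes "\<And>i. algebraic_int (coeff ([:-z, 1:] * q) i)"
  shows "algebraic_int (coeff q i)"
  using assms
proof (induction "degree q" arbitrary: q i rule: less_induct)
  case less
  define p where "p = [:-z, 1:] * q"
  show ?case
  proof (cases "q = 0")
    case False
    define a where "a = lead_coeff q"
    have la: "lead_coeff p = a" unfolding p_def lead_coeff_mult a_def by simp
    have az: "algebraic_int (a * z)"
      using algebraic_int_lead_coeff_mult_root[of p z] less.prems la by (simp add: p_def)
    have aa: "algebraic_int a" using less.prems[of "degree p"] la by (simp only: p_def)
    define q' where "q' = q - monom a (degree q)"
    have c: "coeff q i = coeff q' i + (if i = degree q then a else 0)" for i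
      by (simp add: q'_def)
    show ?thesis
    proof (cases "degree q = 0")
      case True
      then show ?thesis using aa by (cases "i = 0") (auto simp: a_def coeff_eq_0)
    next
      case False
      have "degree q' < degree q"
        by (rule degree_lessI) (use False in \<open>auto simp: q'_def a_def coeff_eq_0\<close>)
      moreover have "algebraic_int (coeff ([:-z, 1:] * q') j)" for j
      proof -
        have "[:-z, 1:] * q' = p - (monom a (Suc (degree q)) - monom (a * z) (degree q))"
          by (simp add: q'_def p_def algebra_simps monom_Suc smult_monom add_monom)
        then have "coeff ([:-z, 1:] * q') j = coeff p j - ((if j = Suc (degree q) then a else 0) - (if j = degree q then a * z else 0))"
          by simp
        moreover have "algebraic_int (coeff p j)" using less.prems unfolding p_def by blast
        moreover have "algebraic_int (if j = Suc (degree q) then a else 0)"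
          "algebraic_int (if j = degree q then a * z else 0)"
          using aa az by simp_all
        ultimately show ?thesis by (simp only: algebraic_int_diff)
      qed
      ultimately have "algebraic_int (coeff q' i)" using less.hyps by blast
      moreover have "algebraic_int (if i = degree q then a else 0)" using aa by simp
      ultimately show ?thesis unfolding c by (rule algebraic_int_add)
    qed
  qed simp
qed

text \<open>The linear factors outside \<open>Y\<close> are divided out one at a time; the leading
  coefficient \<open>a\<close> stays in place throughout.\<close>

lemma algebraic_int_coeff_sublist:
  fixes a :: complex
  assumes "\<And>i. algebraic_int (coeff (smult a (\<Prod>x\<in>S. [:-x, 1:])) i)" "finite S" "Y \<subseteq> S"
  shows "algebraic_int (coeff (smult a (\<Prod>x\<in>Y. [:-x, 1:])) i)"
proof -
  have key: "finite Z \<Longrightarrow> Z \<inter> Y = {} \<Longrightarrow> (\<And>i. algebraic_int (coeff (smult a (\<Prod>x\<in>Y \<union> Z. [:-x, 1:])) i))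
     \<Longrightarrow> algebraic_int (coeff (smult a (\<Prod>x\<in>Y. [:-x, 1:])) i)" for Z i
  proof (induction Z arbitrary: i rule: finite_induct)
    case (insert z Z)
    have "finite Y" using assms finite_subset by blast
    then have "finite (Y \<union> Z)" "z \<notin> Y \<union> Z" using insert.hyps insert.prems(1) by auto
    from prod.insert[OF this, of "\<lambda>x. [:-x, 1:]"]
    have "(\<Prod>x\<in>Y \<union> insert z Z. [:-x, 1:]) = [:-z, 1:] * (\<Prod>x\<in>Y \<union> Z. [:-x, 1:])"
      by (simp only: Un_insert_right)
    then have "smult a (\<Prod>x\<in>Y \<union> insert z Z. [:-x, 1:]) = [:-z, 1:] * smult a (\<Prod>x\<in>Y \<union> Z. [:-x, 1:])"
      by (simp only: mult_smult_right)
    with insert.prems(2) have "algebraic_int (coeff ([:-z, 1:] * smult a (\<Prod>x\<in>Y \<union> Z. [:-x, 1:])) i)" for i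
      by (simp only:)
    then have "algebraic_int (coeff (smult a (\<Prod>x\<in>Y \<union> Z. [:-x, 1:])) i)" for i
      by (rule algebraic_int_coeff_div_linear)
    then show ?case using insert.IH insert.prems(1) by blast
  qed simp
  have "Y \<union> (S - Y) = S" using assms(3) by blast
  then show ?thesis
    by (intro key[of "S - Y"]) (use assms(1,2) in \<open>simp_all only: finite_Diff Diff_disjoint Int_commute\<close>)
qed

text \<open>Up to sign this is the constant term of the partial product over \<open>Y\<close>. A
  single factor \<open>a\<close> thus clears the denominators of any product of distinct roots,
  which keeps the cost in the height inequality proportional to \<open>ln a\<close>.\<close>

lemma algebraic_int_lead_coeff_prod_roots:
  fixes a :: complex
  assumes "\<And>i. algebraic_int (coeff (smult a (\<Prod>x\<in>S. [:-x, 1:])) i)" "finite S" "Y \<subseteq> S"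
  shows "algebraic_int (a * \<Prod>Y)"
proof -
  have "coeff (smult a (\<Prod>x\<in>Y. [:-x, 1:])) 0 = a * (\<Prod>x\<in>Y. - x)"
    by (simp add: poly_0_coeff_0[symmetric] poly_prod)
  also have "\<dots> = (-1) ^ card Y * (a * \<Prod>Y)"
    by (simp add: prod_uminus)
  finally have "(-1) ^ card Y * (a * \<Prod>Y) = coeff (smult a (\<Prod>x\<in>Y. [:-x, 1:])) 0" ..
  then have "algebraic_int ((-1) ^ card Y * (a * \<Prod>Y))"
    using algebraic_int_coeff_sublist[OF assms] by metis
  then show ?thesis by (cases "even (card Y)") auto
qed


section \<open>Minimal polynomials and the height\<close>

abbreviation cpoly :: "int poly \<Rightarrow> complex poly" where
  "cpoly \<equiv> map_poly of_int"

lemma cpoly_iff_coeff_Ints: "(\<forall>i. coeff p i \<in> \<int>) \<longleftrightarrow> (\<exists>q. p = cpoly q)"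
proof
  assume p: "\<forall>i. coeff p i \<in> \<int>"
  define q where "q = map_poly floor (map_poly Re p)"
  have "of_int \<lfloor>Re (coeff p i)\<rfloor> = coeff p i" for i
    using p[rule_format, of i] by (auto elim!: Ints_cases)
  then have "p = cpoly q"
    by (intro poly_eqI) (simp add: q_def coeff_map_poly)
  then show "\<exists>q. p = cpoly q" by blast
qed auto

section \<open>Algebraic numbers form an algebraically closed field\<close>

lemma algebraic_cpoly: "algebraic z \<longleftrightarrow> (\<exists>p. p \<noteq> 0 \<and> poly (cpoly p) z = 0)"
proof -
  have "algebraic z \<longleftrightarrow> (\<exists>q p. q = cpoly p \<and> q \<noteq> 0 \<and> poly q z = 0)"
    unfolding algebraic_def cpoly_iff_coeff_Ints by blast
  then show ?thesis by auto
qed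

text \<open>Clearing denominators reduces the closure properties of algebraic numbers to those of
  algebraic integers.\<close>

lemma algebraic_iff_int_mult_algebraic_int:
  "algebraic (z::complex) \<longleftrightarrow> (\<exists>n::int. n \<noteq> 0 \<and> algebraic_int (of_int n * z))"
proof
  assume "algebraic z"
  then obtain p where p: "p \<noteq> 0" "poly (cpoly p) z = 0"
    unfolding algebraic_cpoly by blast
  have "algebraic_int (lead_coeff (cpoly p) * z)"
    by (rule algebraic_int_lead_coeff_mult_root) (auto simp: p int_imp_algebraic_int)
  then show "\<exists>n::int. n \<noteq> 0 \<and> algebraic_int (of_int n * z)"
    using p by (intro exI[of _ "lead_coeff p"]) simp
next
  assume "\<exists>n::int. n \<noteq> 0 \<and> algebraic_int (of_int n * z)"
  then obtain n :: int and p where p: "n \<noteq> 0" "poly (cpoly p) (of_int n * z) = 0" "lead_coeff p = 1"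
    unfolding algebraic_int_altdef_ipoly by blast
  define q where "q = pcompose p [:0, n:]"
  have "q \<noteq> 0"
  proof -
    have "degree [:0, n:] > 0" using p(1) by simp
    then show ?thesis unfolding q_def using p(3) pcompose_eq_0[of p "[:0, n:]"] by fastforce
  qed
  moreover have "poly (cpoly q) z = 0"
  proof -
    have "cpoly q = pcompose (cpoly p) [:0, of_int n:]"
      by (simp add: q_def of_int_hom.map_poly_pcompose hom_distribs)
    then show ?thesis using p by (simp add: poly_pcompose mult.commute)
  qed
  ultimately show "algebraic z" unfolding algebraic_cpoly by blast
qed

lemma algebraic_closed:
  fixes x y :: complex
  assumes "algebraic x" "algebraic y"
  shows "algebraic (x * y)" "algebraic (x - y)" "algebraic (x + y)"
proof -
  obtain m n :: int where m: "m \<noteq> 0" "algebraic_int (of_int m * x)"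
    and n: "n \<noteq> 0" "algebraic_int (of_int n * y)"
    using assms unfolding algebraic_iff_int_mult_algebraic_int by blast
  have 1: "algebraic_int (of_int k * z)" if "algebraic_int z" for k :: int and z :: complex
    by (rule algebraic_int_mult[OF int_imp_algebraic_int that]) simp
  have e: "of_int (m * n) * (x * y) = (of_int m * x) * (of_int n * y)"
    "of_int (m * n) * (x - y) = of_int n * (of_int m * x) - of_int m * (of_int n * y)"
    "of_int (m * n) * (x + y) = of_int n * (of_int m * x) + of_int m * (of_int n * y)"
    by (simp_all add: algebra_simps)
  have "algebraic_int (of_int (m * n) * (x * y))" "algebraic_int (of_int (m * n) * (x - y))"
    "algebraic_int (of_int (m * n) * (x + y))"
    unfolding e
    by (intro algebraic_int_mult algebraic_int_diff algebraic_int_add 1 m(2) n(2))+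
  moreover have "m * n \<noteq> 0" using m n by simp
  ultimately show "algebraic (x * y)" "algebraic (x - y)" "algebraic (x + y)"
    unfolding algebraic_iff_int_mult_algebraic_int by blast+
qed

lemma algebraic_one: "algebraic (1::complex)"
  by (rule rat_imp_algebraic) simp

lemma algebraic_power: "algebraic (x::complex) \<Longrightarrow> algebraic (x ^ n)"
  by (induction n) (auto intro: algebraic_closed algebraic_one)

lemma algebraic_sum: "(\<And>i. i \<in> I \<Longrightarrow> algebraic (f i :: complex)) \<Longrightarrow> algebraic (sum f I)"
  by (induction I rule: infinite_finite_induct) (auto intro: algebraic_closed)

lemma algebraic_poly:
  assumes "\<And>i. algebraic (coeff p i)" "algebraic (x::complex)"
  shows "algebraic (poly p x)"
  unfolding poly_altdef by (intro algebraic_sum algebraic_closed algebraic_power assms)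

text \<open>After scaling by a common denominator \<open>N\<close> of the coefficients, the leading
  coefficient times \<open>z\<close> is an algebraic integer. The lemma serves to show that finite
  extensions of subfields of \<open>Qbar\<close> stay inside \<open>Qbar\<close>.\<close>

lemma algebraic_root_algebraic_coeffs:
  assumes "p \<noteq> 0" "\<And>i. algebraic (coeff p i)" "poly p z = (0::complex)"
  shows "algebraic z"
proof -
  obtain n :: "nat \<Rightarrow> int" where n: "\<And>i. n i \<noteq> 0" "\<And>i. algebraic_int (of_int (n i) * coeff p i)"
    using assms(2) unfolding algebraic_iff_int_mult_algebraic_int by metis
  define N where "N = (\<Prod>i\<le>degree p. n i)"
  have N: "N \<noteq> 0" using n by (simp add: N_def)
  have "algebraic_int (coeff (smult (of_int N) p) i)" for i
  proof (cases "i \<le> degree p")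
    case True
    then have "N = (\<Prod>i\<in>{..degree p} - {i}. n i) * n i"
      unfolding N_def by (subst prod.remove[of _ i]) auto
    then have "coeff (smult (of_int N) p) i
        = of_int (\<Prod>i\<in>{..degree p} - {i}. n i) * (of_int (n i) * coeff p i)"
      by (simp add: mult.assoc)
    then show ?thesis
      using algebraic_int_mult[OF int_imp_algebraic_int n(2)] by (metis Ints_of_int)
  qed (simp add: coeff_eq_0)
  then have "algebraic_int (lead_coeff (smult (of_int N) p) * z)"
    by (rule algebraic_int_lead_coeff_mult_root) (use assms in simp)
  then have "algebraic (lead_coeff (smult (of_int N) p) * z)" by blast
  moreover have "lead_coeff (smult (of_int N) p) = of_int N * lead_coeff p"
    using N by simp
  ultimately have 1: "algebraic (of_int N * lead_coeff p * z)" by (simp only:)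
  have "algebraic (of_int N * lead_coeff p)"
    by (intro algebraic_closed assms(2) rat_imp_algebraic) auto
  then have "algebraic (inverse (of_int N * lead_coeff p))" by blast
  from algebraic_closed(1)[OF this 1] show ?thesis
    using N assms(1) by (simp add: field_simps)
qed

section \<open>Minimal polynomials over the integers\<close>

lemma int_poly_root_min_degree:
  assumes "algebraic z"
  obtains m where "m \<noteq> 0" "poly (cpoly m) z = 0"
    "\<And>p. p \<noteq> 0 \<Longrightarrow> poly (cpoly p) z = 0 \<Longrightarrow> degree m \<le> degree p"
proof -
  define P where "P p \<longleftrightarrow> p \<noteq> 0 \<and> poly (cpoly p) z = 0" for p
  have "\<exists>p. P p" using assms unfolding P_def algebraic_cpoly .
  then obtain m where "P m" "\<And>p. P p \<Longrightarrow> degree m \<le> degree p"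
    using ex_has_least_nat[of P _ degree] by metis
  then show thesis using that by (auto simp: P_def)
qed

text \<open>The integer polynomials only admit pseudo-division, hence the constant \<open>c\<close>,
  a power of the leading coefficient of \<open>m\<close>. The remainder vanishes at
  \<open>z\<close>, so minimality of the degree forces it to be zero.\<close>

lemma min_degree_dvd_smult:
  assumes "m \<noteq> 0" "poly (cpoly m) z = 0"
    "\<And>p. p \<noteq> 0 \<Longrightarrow> poly (cpoly p) z = 0 \<Longrightarrow> degree m \<le> degree p"
    and "poly (cpoly p) z = 0"
  shows "\<exists>c. c \<noteq> 0 \<and> m dvd smult c p"
proof -
  obtain q r where qr: "pseudo_divmod p m = (q, r)" by fastforce
  define c where "c = coeff m (degree m) ^ (Suc (degree p) - degree m)"
  have e: "smult c p = m * q + r" and r: "r = 0 \<or> degree r < degree m"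
    using pseudo_divmod[OF assms(1) qr] by (simp_all add: c_def)
  have "cpoly (smult c p) = cpoly m * cpoly q + cpoly r"
    unfolding e by (simp add: hom_distribs)
  moreover have "poly (cpoly (smult c p)) z = 0"
    using assms(4) by (simp add: hom_distribs)
  ultimately have "poly (cpoly r) z = 0" using assms(2) by simp
  then have "r = 0" using assms(3)[of r] r leD by blast
  then show ?thesis using e assms(1) by (intro exI[of _ c]) (auto simp: c_def)
qed

text \<open>Primality of \<open>f\<close> among the integer polynomials acts as Gauss's lemma twice:
  it shows that \<open>f\<close> has minimal degree among the polynomials vanishing at
  \<open>z\<close>, and it removes the constant left over by pseudo-division.\<close>

lemma irreducible_root_dvd:
  fixes f p :: "int poly"
  assumes "Factorial_Ring.irreducible f" "poly (cpoly f) z = 0" "poly (cpoly p) z = 0"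
  shows "f dvd p"
proof -
  have f0: "f \<noteq> 0" using assms(1) by auto
  then have "algebraic z" unfolding algebraic_cpoly using assms(2) by blast
  then obtain m where m: "m \<noteq> 0" "poly (cpoly m) z = 0"
    "\<And>p. p \<noteq> 0 \<Longrightarrow> poly (cpoly p) z = 0 \<Longrightarrow> degree m \<le> degree p"
    by (rule int_poly_root_min_degree) blast
  have prime: "prime_elem f" using assms(1) by (rule irreducible_imp_prime_elem)
  have degpos: "degree q > 0" if "q \<noteq> 0" "poly (cpoly q) z = 0" for q
    using that by (intro Nat.gr0I) (auto elim!: degree_eq_zeroE simp: hom_distribs)
  obtain c s where c: "c \<noteq> 0" "smult c f = m * s"
    using min_degree_dvd_smult[OF m assms(2)] unfolding dvd_def by blast
  have "f dvd m * s" using c(2) by (metis dvd_smult dvd_refl)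
  then consider "f dvd m" | "f dvd s" unfolding prime_elem_dvd_mult_iff[OF prime] by blast
  then have "degree f \<le> degree m"
  proof cases
    case 1
    then show ?thesis using m(1) by (rule dvd_imp_degree_le)
  next
    case 2
    then obtain t where "s = f * t" by blast
    then have "f * [:c:] = f * (m * t)" using c(2) by (simp add: ac_simps)
    then have "[:c:] = m * t" using f0 by (metis mult_cancel_left)
    then have "degree m + degree t = 0"
      using c(1) m(1) by (metis degree_mult_eq degree_pCons_0 mult_eq_0_iff pCons_eq_0_iff)
    then show ?thesis using degpos[OF m(1,2)] by simp
  qed
  then have f: "\<And>p. p \<noteq> 0 \<Longrightarrow> poly (cpoly p) z = 0 \<Longrightarrow> degree f \<le> degree p"
    using m(3) le_trans by blast
  obtain c where "c \<noteq> 0" "f dvd smult c p"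
    using min_degree_dvd_smult[OF f0 assms(2) f assms(3)] by blast
  then have "f dvd [:c:] * p" by simp
  then have "f dvd [:c:] \<or> f dvd p" unfolding prime_elem_dvd_mult_iff[OF prime] .
  moreover have "\<not> f dvd [:c:]"
    using \<open>c \<noteq> 0\<close> degpos[OF f0 assms(2)] dvd_imp_degree_le[of f "[:c:]"] by auto
  ultimately show ?thesis by blast
qed

text \<open>A prime factor of any polynomial vanishing at \<alpha> vanishes there itself, and
  normalisation makes its leading coefficient positive. Two candidates divide each other, so the
  definite description is legitimate.\<close>

lemma min_int_poly:
  assumes "algebraic \<alpha>"
  shows "Factorial_Ring.irreducible (min_int_poly \<alpha>)" "lead_coeff (min_int_poly \<alpha>) > 0"
    "poly (cpoly (min_int_poly \<alpha>)) \<alpha> = 0"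
proof -
  let ?P = "\<lambda>p. Factorial_Ring.irreducible p \<and> lead_coeff p > 0 \<and> poly (cpoly p) \<alpha> = 0"
  obtain p where p: "p \<noteq> 0" "poly (cpoly p) \<alpha> = 0"
    using assms unfolding algebraic_cpoly by blast
  have "p dvd prod_mset (prime_factorization p)"
    using prod_mset_prime_factorization_weak[OF p(1)] by (metis associated_iff_dvd)
  then obtain q where "prod_mset (prime_factorization p) = p * q" by blast
  then have "poly (cpoly (prod_mset (prime_factorization p))) \<alpha> = 0" using p by (simp add: hom_distribs)
  moreover have "poly (cpoly (prod_mset M)) \<alpha> = 0 \<Longrightarrow> \<exists>q\<in>#M. poly (cpoly q) \<alpha> = 0" for M
    by (induction M) (auto simp: hom_distribs)
  ultimately obtain q where q: "q \<in># prime_factorization p" "poly (cpoly q) \<alpha> = 0" by metis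
  then have "Factorial_Ring.prime q" by (simp add: in_prime_factors_imp_prime)
  then have pq: "prime_elem q" "normalize q = q" by (auto simp: prime_def)
  then have q0: "q \<noteq> 0" by auto
  have "unit_factor q = 1" using pq(2) q0
    by (metis mult_cancel_left mult.right_neutral normalize_mult_unit_factor)
  then have "[:sgn (lead_coeff q):] = [:1:]" unfolding unit_factor_poly_def pCons_one by simp
  then have "sgn (lead_coeff q) = 1" by simp
  then have "?P q" using pq q by (auto simp: prime_elem_imp_irreducible sgn_if split: if_splits)
  moreover have "r = q" if "?P r" for r
  proof -
    have "r dvd q" "q dvd r"
      using irreducible_root_dvd[of _ \<alpha>] that \<open>?P q\<close> by auto
    then have "normalize r = normalize q" by (simp add: associated_iff_dvd)
    moreover have "normalize s = s" if "lead_coeff s > 0" for s :: "int poly"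
    proof -
      have "unit_factor s = 1" using that by (simp add: unit_factor_poly_def pCons_one)
      then show ?thesis by (metis mult.right_neutral normalize_mult_unit_factor)
    qed
    ultimately show ?thesis using that \<open>?P q\<close> by metis
  qed
  ultimately have "?P (min_int_poly \<alpha>)" unfolding min_int_poly_def by (rule theI)
  then show "Factorial_Ring.irreducible (min_int_poly \<alpha>)" "lead_coeff (min_int_poly \<alpha>) > 0"
    "poly (cpoly (min_int_poly \<alpha>)) \<alpha> = 0" by blast+
qed

text \<open>A common root of \<open>f\<close> and its derivative would make \<open>f\<close> divide
  a nonzero polynomial of smaller degree. Hence all roots are simple, and sums and products over the
  set \<open>Z\<close> count every conjugate once.\<close>

lemma irreducible_decompose:
  fixes f :: "int poly"
  assumes "Factorial_Ring.irreducible f" "degree f > 0"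
  defines "Z \<equiv> {z. poly (cpoly f) z = 0}"
  shows "cpoly f = smult (of_int (lead_coeff f)) (\<Prod>z\<in>Z. [:-z, 1:])"
    "card Z = degree f" "finite Z"
proof -
  have f0: "f \<noteq> 0" using assms by auto
  then show "finite Z" unfolding Z_def by (intro poly_roots_finite) simp
  have "rsquarefree (cpoly f)"
    unfolding rsquarefree_roots
  proof (intro allI notI, elim conjE)
    fix a assume a: "poly (cpoly f) a = 0" "poly (pderiv (cpoly f)) a = 0"
    then have "poly (cpoly (pderiv f)) a = 0" by (simp add: of_int_hom.map_poly_pderiv)
    then have "f dvd pderiv f" using irreducible_root_dvd[OF assms(1) a(1)] by blast
    moreover have "degree (pderiv f) < degree f" using assms(2) by (simp add: degree_pderiv)
    ultimately have "pderiv f = 0" using dvd_imp_degree_le leD by blast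
    then show False using assms(2) by (simp add: pderiv_eq_0_iff)
  qed
  from complex_poly_decompose_rsquarefree[OF this]
  show e: "cpoly f = smult (of_int (lead_coeff f)) (\<Prod>z\<in>Z. [:-z, 1:])"
    by (simp add: Z_def)
  have "degree f = degree (cpoly f)" by simp
  also have "\<dots> = degree (\<Prod>z\<in>Z. [:-z, 1:])" unfolding e using f0 by simp
  also have "\<dots> = card Z" by (subst degree_prod_sum_eq) auto
  finally show "card Z = degree f" ..
qed

lemma min_int_poly_degree_pos: "algebraic \<alpha> \<Longrightarrow> degree (min_int_poly \<alpha>) > 0"
  using min_int_poly[of \<alpha>] by (intro Nat.gr0I) (auto elim!: degree_eq_zeroE simp: hom_distribs)

section \<open>The height as a sum over conjugates\<close>

lemma weil_height_eq:
  assumes "algebraic \<alpha>"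
  defines "f \<equiv> min_int_poly \<alpha>"
  defines "Z \<equiv> {z. poly (cpoly f) z = 0}"
  shows "real (degree f) * weil_height \<alpha>
    = ln (of_int (lead_coeff f)) + (\<Sum>z\<in>Z. ln (max 1 (cmod z)))"
proof -
  have d: "degree f > 0" and lf: "lead_coeff f > 0" and irr: "Factorial_Ring.irreducible f"
    using min_int_poly_degree_pos min_int_poly assms by auto
  note dec = irreducible_decompose[OF irr d, folded Z_def]
  obtain zs where zs: "set zs = Z" "distinct zs" using finite_distinct_list[OF dec(3)] by blast
  have "mahler_measure f = mahler_measure_poly (smult (of_int (lead_coeff f)) (\<Prod>z\<leftarrow>zs. [:-z, 1:]))"
    unfolding mahler_measure_def dec(1) by (simp add: prod.distinct_set_conv_list zs flip: zs(1))
  also have "\<dots> = of_int (lead_coeff f) * (\<Prod>z\<leftarrow>zs. max 1 (cmod z))"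
    unfolding mahler_measure_poly_explicit using lf by simp
  also have "(\<Prod>z\<leftarrow>zs. max 1 (cmod z)) = (\<Prod>z\<in>Z. max 1 (cmod z))"
    by (simp add: prod.distinct_set_conv_list zs flip: zs(1))
  finally have "mahler_measure f = of_int (lead_coeff f) * (\<Prod>z\<in>Z. max 1 (cmod z))" .
  moreover have "(\<Prod>z\<in>Z. max 1 (cmod z)) > 0" by (rule prod_pos) (simp add: less_max_iff_disj)
  ultimately have "ln (mahler_measure f) = ln (of_int (lead_coeff f)) + ln (\<Prod>z\<in>Z. max 1 (cmod z))"
    using lf by (simp only: ln_mult_pos of_int_0_less_iff)
  moreover have "ln (\<Prod>z\<in>Z. max 1 (cmod z)) = (\<Sum>z\<in>Z. ln (max 1 (cmod z)))"
    by (rule ln_prod) (auto simp: dec(3) less_max_iff_disj)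
  ultimately show ?thesis using d by (simp add: weil_height_def f_def)
qed


section \<open>Extension of embeddings\<close>

lemma CC_simps [simp]:
  "carrier CC = UNIV" "monoid.mult CC = (*)" "ring.add CC = (+)" "monoid.one CC = 1" "ring.zero CC = 0"
  by (auto simp: ring_of_type_algebra_def)

lemma Qbar_closed:
  "x \<in> Qbar \<Longrightarrow> y \<in> Qbar \<Longrightarrow> x + y \<in> Qbar"
  "x \<in> Qbar \<Longrightarrow> y \<in> Qbar \<Longrightarrow> x - y \<in> Qbar"
  "x \<in> Qbar \<Longrightarrow> y \<in> Qbar \<Longrightarrow> x * y \<in> Qbar"
  "x \<in> Qbar \<Longrightarrow> - x \<in> Qbar"
  "x \<in> Qbar \<Longrightarrow> inverse x \<in> Qbar"
  "x \<in> Qbar \<Longrightarrow> cnj x \<in> Qbar"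
  "of_int n \<in> Qbar" "1 \<in> Qbar" "0 \<in> Qbar"
  unfolding Qbar_def by (auto intro: algebraic_closed rat_imp_algebraic)

lemma Gal_Qbar_iff:
  "\<sigma> \<in> Gal_Qbar K \<longleftrightarrow> bij_betw \<sigma> Qbar Qbar \<and> \<sigma> 1 = 1 \<and>
     (\<forall>x\<in>Qbar. \<forall>y\<in>Qbar. \<sigma> (x + y) = \<sigma> x + \<sigma> y \<and> \<sigma> (x * y) = \<sigma> x * \<sigma> y) \<and> (\<forall>x\<in>K. \<sigma> x = x)"
  unfolding Gal_Qbar_def ring_iso_def Ring.ring_hom_def
  by (auto dest: bij_betw_apply simp: Pi_iff)

lemma Gal_Qbar_mono: "\<sigma> \<in> Gal_Qbar K \<Longrightarrow> L \<subseteq> K \<Longrightarrow> \<sigma> \<in> Gal_Qbar L"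
  unfolding Gal_Qbar_iff by blast

text \<open>The graphs of ring homomorphisms from a ring of algebraic numbers to \<open>\<complex>\<close>. As sets of pairs
  they are closed under unions of chains, and no subring has to be carried along.\<close>

definition partial_hom :: "(complex \<times> complex) set \<Rightarrow> bool" where
  "partial_hom R \<longleftrightarrow> (1, 1) \<in> R \<and>
     (\<forall>x y u v. (x, y) \<in> R \<longrightarrow> (u, v) \<in> R \<longrightarrow> (x - u, y - v) \<in> R \<and> (x * u, y * v) \<in> R) \<and>
     (\<forall>x y. (x, y) \<in> R \<longrightarrow> algebraic x) \<and> (\<forall>y. (0, y) \<in> R \<longrightarrow> y = 0)"

text \<open>The pairs consisting of a polynomial and its image under the homomorphism with graph \<open>R\<close>.\<close>

definition coeff_pairs :: "(complex \<times> complex) set \<Rightarrow> (complex poly \<times> complex poly) set" where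
  "coeff_pairs R = {(p, q). \<forall>i. (coeff p i, coeff q i) \<in> R}"

text \<open>The candidate for an extension sending \<open>a\<close> to \<open>b\<close>. For
  arbitrary \<open>b\<close> this relation need not be single-valued.\<close>

definition adjoin :: "(complex \<times> complex) set \<Rightarrow> complex \<Rightarrow> complex \<Rightarrow> (complex \<times> complex) set" where
  "adjoin R a b = (\<lambda>(p, q). (poly p a, poly q b)) ` coeff_pairs R"

context
  fixes R assumes R: "partial_hom R"
begin

lemma partial_hom_one: "(1, 1) \<in> R"
  and partial_hom_diff: "(x, y) \<in> R \<Longrightarrow> (u, v) \<in> R \<Longrightarrow> (x - u, y - v) \<in> R"
  and partial_hom_mult: "(x, y) \<in> R \<Longrightarrow> (u, v) \<in> R \<Longrightarrow> (x * u, y * v) \<in> R"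
  and partial_hom_algebraic: "(x, y) \<in> R \<Longrightarrow> algebraic x"
  and partial_hom_zeroD: "(0, y) \<in> R \<Longrightarrow> y = 0"
  using R unfolding partial_hom_def by blast+

lemma partial_hom_zero: "(0, 0) \<in> R"
  using partial_hom_diff[OF partial_hom_one partial_hom_one] by simp

lemma partial_hom_add: "(x, y) \<in> R \<Longrightarrow> (u, v) \<in> R \<Longrightarrow> (x + u, y + v) \<in> R"
  using partial_hom_diff[of x y "- u" "- v"] partial_hom_diff[OF partial_hom_zero, of u v] by simp

lemma partial_hom_sum: "(\<And>i. i \<in> I \<Longrightarrow> (f i, g i) \<in> R) \<Longrightarrow> (sum f I, sum g I) \<in> R"
  by (induction I rule: infinite_finite_induct) (auto intro: partial_hom_zero partial_hom_add)

lemma partial_hom_of_int: "(of_int n, of_int n) \<in> R"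
proof (induction n rule: int_induct[where k = 0])
  case base
  then show ?case by (simp add: partial_hom_zero)
next
  case (step1 i)
  then show ?case using partial_hom_add[OF _ partial_hom_one] by simp
next
  case (step2 i)
  then show ?case using partial_hom_diff[OF _ partial_hom_one] by simp
qed

text \<open>Closure under differences reduces single-valuedness to the image of 0.\<close>

lemma partial_hom_unique: "(x, y) \<in> R \<Longrightarrow> (x, y') \<in> R \<Longrightarrow> y = y'"
  using partial_hom_diff[of x y x y'] partial_hom_zeroD[of "y - y'"] by simp

lemma partial_hom_poly:
  "(p, q) \<in> coeff_pairs R \<Longrightarrow> (x, y) \<in> R \<Longrightarrow> (poly p x, poly q y) \<in> R"
proof (induction p arbitrary: q rule: measure_induct_rule[of degree])
  case (less p)
  obtain a p' where p: "p = pCons a p'" by (cases p)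
  obtain b q' where q: "q = pCons b q'" by (cases q)
  have ab: "(a, b) \<in> R" using less.prems(1) unfolding coeff_pairs_def p q
    by (auto dest: spec[of _ 0])
  have c: "(coeff p' i, coeff q' i) \<in> R" for i
    using less.prems(1) unfolding coeff_pairs_def p q by (auto dest: spec[of _ "Suc i"])
  show ?case
  proof (cases "p' = 0")
    case True
    then have "coeff q' i = 0" for i using c[of i] partial_hom_zeroD by simp
    then have "q' = 0" by (simp add: poly_eq_iff)
    then show ?thesis using True ab by (simp add: p q)
  next
    case False
    have "(poly p' x, poly q' y) \<in> R"
      by (rule less.IH) (use False c less.prems(2) in \<open>auto simp: p coeff_pairs_def\<close>)
    then show ?thesis using ab less.prems(2) unfolding p q poly_pCons
      by (intro partial_hom_add partial_hom_mult)
  qed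
qed

lemma coeff_pairs_cpoly: "(cpoly p, cpoly p) \<in> coeff_pairs R"
  by (simp add: coeff_pairs_def partial_hom_of_int)

text \<open>The domain is only a ring, so injectivity comes from algebraicity: if
  \<open>x \<noteq> 0\<close> is sent to 0, then an integer polynomial of minimal degree vanishing
  at \<open>x\<close> has constant term 0, and cancelling the factor X contradicts
  minimality.\<close>

lemma partial_hom_inj: "(x, 0) \<in> R \<Longrightarrow> x = 0"
proof (rule ccontr)
  assume x: "(x, 0) \<in> R" "x \<noteq> 0"
  obtain p where p: "p \<noteq> 0" "poly (cpoly p) x = 0"
    "\<And>r. r \<noteq> 0 \<Longrightarrow> poly (cpoly r) x = 0 \<Longrightarrow> degree p \<le> degree r"
    using int_poly_root_min_degree[OF partial_hom_algebraic[OF x(1)]] by metis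
  obtain a p' where pc: "p = pCons a p'" by (cases p)
  have "(poly (cpoly p) x, poly (cpoly p) 0) \<in> R"
    by (rule partial_hom_poly[OF coeff_pairs_cpoly x(1)])
  then have "a = 0" using p partial_hom_zeroD[of "of_int a"] by (simp add: pc hom_distribs)
  then have "p' \<noteq> 0" "poly (cpoly p') x = 0" "degree p' < degree p"
    using p(1,2) x(2) by (auto simp: pc hom_distribs)
  then show False using p(3)[of p'] by simp
qed

lemma coeff_pairs_fst_0: "(0, q) \<in> coeff_pairs R \<Longrightarrow> q = 0"
  using partial_hom_zeroD by (auto simp: coeff_pairs_def poly_eq_iff)

lemma coeff_pairs_diff: "(p, q) \<in> coeff_pairs R \<Longrightarrow> (r, s) \<in> coeff_pairs R \<Longrightarrow> (p - r, q - s) \<in> coeff_pairs R"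
  by (auto simp: coeff_pairs_def intro: partial_hom_diff)

lemma coeff_pairs_mult: "(p, q) \<in> coeff_pairs R \<Longrightarrow> (r, s) \<in> coeff_pairs R \<Longrightarrow> (p * r, q * s) \<in> coeff_pairs R"
  by (auto simp: coeff_pairs_def coeff_mult intro!: partial_hom_sum partial_hom_mult)

lemma coeff_pairs_monom: "(a, b) \<in> R \<Longrightarrow> (monom a n, monom b n) \<in> coeff_pairs R"
  by (auto simp: coeff_pairs_def partial_hom_zero)

lemma coeff_pairs_degree: "(p, q) \<in> coeff_pairs R \<Longrightarrow> degree q = degree p"
proof -
  assume pq: "(p, q) \<in> coeff_pairs R"
  have "coeff p i = 0 \<longleftrightarrow> coeff q i = 0" for i
  proof -
    have "(coeff p i, coeff q i) \<in> R" using pq by (simp add: coeff_pairs_def)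
    then show ?thesis using partial_hom_zeroD partial_hom_inj by metis
  qed
  then show ?thesis unfolding degree_def by simp
qed

lemma subset_adjoin: "R \<subseteq> adjoin R a b"
proof
  fix z assume "z \<in> R"
  then have "(monom (fst z) 0, monom (snd z) 0) \<in> coeff_pairs R"
    by (intro coeff_pairs_monom) simp
  then show "z \<in> adjoin R a b"
    unfolding adjoin_def by (rule rev_image_eqI) (simp add: poly_monom)
qed

lemma adjoin_contains: "(a, b) \<in> adjoin R a b"
  unfolding adjoin_def
  by (rule image_eqI[OF _ coeff_pairs_monom[OF partial_hom_one, of 1]]) (simp add: poly_monom)

lemma partial_hom_adjoin:
  assumes "algebraic a"
    and "\<And>p q. (p, q) \<in> coeff_pairs R \<Longrightarrow> poly p a = 0 \<Longrightarrow> poly q b = 0"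
  shows "partial_hom (adjoin R a b)"
  unfolding partial_hom_def
proof (intro conjI allI impI)
  show "(1, 1) \<in> adjoin R a b" using subset_adjoin partial_hom_one by blast
next
  fix x y u v assume "(x, y) \<in> adjoin R a b" "(u, v) \<in> adjoin R a b"
  then obtain p q r s where pq: "(p, q) \<in> coeff_pairs R" "(r, s) \<in> coeff_pairs R"
    and e: "x = poly p a" "y = poly q b" "u = poly r a" "v = poly s b"
    unfolding adjoin_def by auto
  show "(x - u, y - v) \<in> adjoin R a b" unfolding adjoin_def
    by (rule image_eqI[OF _ coeff_pairs_diff[OF pq]]) (simp add: e)
  show "(x * u, y * v) \<in> adjoin R a b" unfolding adjoin_def
    by (rule image_eqI[OF _ coeff_pairs_mult[OF pq]]) (simp add: e)
next
  fix x y assume "(x, y) \<in> adjoin R a b"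
  then obtain p q where "(p, q) \<in> coeff_pairs R" "x = poly p a" unfolding adjoin_def by auto
  moreover from this have "algebraic (coeff p i)" for i
    using partial_hom_algebraic by (auto simp: coeff_pairs_def)
  ultimately show "algebraic x" using algebraic_poly[of p a] assms(1) by simp
next
  fix y assume "(0, y) \<in> adjoin R a b"
  then show "y = 0" unfolding adjoin_def using assms(2) by auto
qed

text \<open>The image \<open>b\<close> is a root of the polynomial corresponding to a polynomial
  \<open>p0\<close> of minimal degree that vanishes at \<open>a\<close>. Every other relation
  satisfied by \<open>a\<close> reduces to \<open>p0\<close> by pseudo-division, so it is satisfied
  by \<open>b\<close> on the other side.\<close>

lemma partial_hom_extend:
  assumes "algebraic a"
  obtains R' b where "partial_hom R'" "R \<subseteq> R'" "(a, b) \<in> R'"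
proof -
  define P where "P z \<longleftrightarrow> z \<in> coeff_pairs R \<and> fst z \<noteq> 0 \<and> poly (fst z) a = 0" for z
  obtain p where "p \<noteq> 0" "poly (cpoly p) a = 0" using assms unfolding algebraic_cpoly by blast
  then have "P (cpoly p, cpoly p)" using coeff_pairs_cpoly by (simp add: P_def)
  then obtain z where "P z" "\<And>w. P w \<Longrightarrow> degree (fst z) \<le> degree (fst w)"
    using ex_has_least_nat[of P _ "\<lambda>z. degree (fst z)"] by metis
  then obtain p0 q0 where pq0: "(p0, q0) \<in> coeff_pairs R" "p0 \<noteq> 0" "poly p0 a = 0"
    and min: "\<And>p q. (p, q) \<in> coeff_pairs R \<Longrightarrow> p \<noteq> 0 \<Longrightarrow> poly p a = 0 \<Longrightarrow> degree p0 \<le> degree p"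
    unfolding P_def by (metis fst_conv prod.collapse)
  have "degree p0 > 0"
    using pq0(2,3) by (intro Nat.gr0I) (auto elim!: degree_eq_zeroE)
  then have dq0: "degree q0 > 0" "degree q0 = degree p0"
    using coeff_pairs_degree[OF pq0(1)] by auto
  then have "\<not> constant (poly q0)" by (simp add: constant_degree)
  then obtain b where b: "poly q0 b = 0" using fundamental_theorem_of_algebra by blast
  define c c' where "c = lead_coeff p0" and "c' = lead_coeff q0"
  have cc: "(c, c') \<in> R" using pq0(1) dq0(2) by (simp add: coeff_pairs_def c_def c'_def)
  have "q0 \<noteq> 0" using dq0(1) by auto
  then have c0: "c \<noteq> 0" "c' \<noteq> 0" using pq0(2) by (simp_all add: c_def c'_def)
  have "(p, q) \<in> coeff_pairs R \<Longrightarrow> poly p a = 0 \<Longrightarrow> poly q b = 0" for p q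
  proof (induction p arbitrary: q rule: measure_induct_rule[of degree])
    case (less p)
    show ?case
    proof (cases "p = 0")
      case True
      then show ?thesis using less.prems(1) coeff_pairs_fst_0 by fastforce
    next
      case False
      then have le: "degree p0 \<le> degree p" using min less.prems by blast
      define k where "k = degree p - degree p0"
      define e e' where "e = lead_coeff p" and "e' = lead_coeff q"
      have dq: "degree q = degree p" using coeff_pairs_degree[OF less.prems(1)] .
      have ee: "(e, e') \<in> R" using less.prems(1) dq by (simp add: coeff_pairs_def e_def e'_def)
      \<comment> \<open>One step of pseudo-division, carried out in parallel on both sides. The
        leading terms on the left cancel; on the right, \<open>c' \<noteq> 0\<close> allows
        returning from a root of \<open>q1\<close> to a root of \<open>q\<close>.\<close>
      define p1 q1 where "p1 = monom c 0 * p - monom e k * p0" and "q1 = monom c' 0 * q - monom e' k * q0"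
      have "(p1, q1) \<in> coeff_pairs R" unfolding p1_def q1_def
        by (intro coeff_pairs_diff coeff_pairs_mult coeff_pairs_monom cc ee less.prems(1) pq0(1))
      moreover have "poly p1 a = 0" using less.prems(2) pq0(3) by (simp add: p1_def)
      moreover have "degree p1 < degree p"
      proof (rule degree_lessI)
        show "p1 \<noteq> 0 \<or> degree p > 0" using le \<open>degree p0 > 0\<close> by simp
        show "\<forall>i\<ge>degree p. coeff p1 i = 0"
        proof (intro allI impI)
          fix i assume i: "i \<ge> degree p"
          have "coeff p1 i = c * coeff p i - e * coeff p0 (i - k)"
            using i by (simp add: p1_def coeff_monom_mult k_def)
          moreover have "i - k \<ge> degree p0" using i le by (simp add: k_def)
          ultimately show "coeff p1 i = 0"
            using i le by (cases "i = degree p") (auto simp: c_def e_def k_def coeff_eq_0)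
        qed
      qed
      ultimately have "poly q1 b = 0" using less.IH by blast
      then show ?thesis using b c0 by (simp add: q1_def poly_monom)
    qed
  qed
  with partial_hom_adjoin[OF assms] subset_adjoin adjoin_contains show thesis
    using that by blast
qed

end

section \<open>Extension to automorphisms of the algebraic numbers\<close>

lemma partial_hom_total:
  assumes "partial_hom R"
  obtains M where "partial_hom M" "R \<subseteq> M" "\<And>x. algebraic x \<Longrightarrow> \<exists>y. (x, y) \<in> M"
proof -
  define A where "A = {M. partial_hom M \<and> R \<subseteq> M}"
  have "\<exists>M\<in>A. \<forall>N\<in>A. M \<subseteq> N \<longrightarrow> N = M"
  proof (rule subset_Zorn_nonempty)
    show "A \<noteq> {}" using assms by (auto simp: A_def)
  next
    fix D assume D: "D \<noteq> {}" "subset.chain A D"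
    then have DA: "D \<subseteq> A" and lin: "\<And>M N. M \<in> D \<Longrightarrow> N \<in> D \<Longrightarrow> M \<subseteq> N \<or> N \<subseteq> M"
      by (auto simp: subset_chain_def)
    have ph: "partial_hom M" if "M \<in> D" for M using DA that by (auto simp: A_def)
    have pair: "\<exists>M\<in>D. z \<in> M \<and> w \<in> M" if "z \<in> \<Union>D" "w \<in> \<Union>D" for z w
      using that lin by blast
    have "partial_hom (\<Union>D)"
      unfolding partial_hom_def
    proof (intro conjI allI impI)
      show "(1, 1) \<in> \<Union>D" using D(1) ph partial_hom_one by blast
    next
      fix x y u v assume "(x, y) \<in> \<Union>D" "(u, v) \<in> \<Union>D"
      then obtain M where "M \<in> D" "(x, y) \<in> M" "(u, v) \<in> M" using pair by blast
      then show "(x - u, y - v) \<in> \<Union>D" "(x * u, y * v) \<in> \<Union>D"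
        using partial_hom_diff[OF ph] partial_hom_mult[OF ph] by blast+
    next
      fix x y assume "(x, y) \<in> \<Union>D"
      then show "algebraic x" using partial_hom_algebraic[OF ph] by blast
    next
      fix y assume "(0, y) \<in> \<Union>D"
      then show "y = 0" using partial_hom_zeroD[OF ph] by blast
    qed
    moreover have "R \<subseteq> \<Union>D" using D(1) DA by (auto simp: A_def)
    ultimately show "\<Union>D \<in> A" by (simp add: A_def)
  qed
  then obtain M where MA: "M \<in> A" and max: "\<forall>N\<in>A. M \<subseteq> N \<longrightarrow> N = M" ..
  then have M: "partial_hom M" "R \<subseteq> M" by (simp_all add: A_def)
  have "\<exists>y. (x, y) \<in> M" if x: "algebraic x" for x
  proof -
    obtain N y where N: "partial_hom N" "M \<subseteq> N" "(x, y) \<in> N"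
      using partial_hom_extend[OF M(1) x] by metis
    then have "N \<in> A" using M(2) by (simp add: A_def)
    then show ?thesis using max N by blast
  qed
  with M show thesis by (rule that)
qed

text \<open>Zorn's lemma only yields an injective homomorphism. It is surjective because it maps the
  finite root set of every integer polynomial injectively into itself.\<close>

lemma partial_hom_Gal_Qbar:
  assumes "partial_hom R"
  shows "\<exists>\<sigma>\<in>Gal_Qbar {}. \<forall>(x, y)\<in>R. \<sigma> x = y"
proof -
  obtain M where M: "partial_hom M" "R \<subseteq> M" and tot: "\<And>x. algebraic x \<Longrightarrow> \<exists>y. (x, y) \<in> M"
    using partial_hom_total[OF assms] by blast
  define \<sigma> where "\<sigma> x = (SOME y. (x, y) \<in> M)" for x
  have \<sigma>M: "(x, \<sigma> x) \<in> M" if "x \<in> Qbar" for x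
    unfolding \<sigma>_def using someI_ex[OF tot] that by (simp add: Qbar_def)
  have \<sigma>eq: "\<sigma> x = y" if "(x, y) \<in> M" for x y
    using \<sigma>M[of x] that partial_hom_unique[OF M(1)] partial_hom_algebraic[OF M(1)]
    by (metis Qbar_def mem_Collect_eq)
  have root: "poly (cpoly p) (\<sigma> x) = 0" if "x \<in> Qbar" "poly (cpoly p) x = 0" for p x
    using partial_hom_poly[OF M(1) coeff_pairs_cpoly[OF M(1)] \<sigma>M[OF that(1)], of p] that(2)
      partial_hom_zeroD[OF M(1)] by simp
  have inj: "inj_on \<sigma> Qbar"
  proof (rule inj_onI)
    fix x y assume "x \<in> Qbar" "y \<in> Qbar" "\<sigma> x = \<sigma> y"
    then have "(x - y, 0) \<in> M" using partial_hom_diff[OF M(1) \<sigma>M \<sigma>M, of x y] by simp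
    then show "x = y" using partial_hom_inj[OF M(1)] by fastforce
  qed
  have img: "x \<in> \<sigma> ` Qbar" "\<sigma> x \<in> Qbar" if x: "x \<in> Qbar" for x
  proof -
    obtain p where p: "p \<noteq> 0" "poly (cpoly p) x = 0"
      using x unfolding Qbar_def algebraic_cpoly by blast
    define Z where "Z = {z. poly (cpoly p) z = 0}"
    have ZQ: "Z \<subseteq> Qbar" using p(1) unfolding Z_def Qbar_def algebraic_cpoly by blast
    have "\<sigma> ` Z \<subseteq> Z" using root ZQ by (auto simp: Z_def)
    moreover have "finite Z" unfolding Z_def by (rule poly_roots_finite) (use p in simp)
    ultimately have "\<sigma> ` Z = Z"
      using inj ZQ by (intro endo_inj_surj) (auto intro: inj_on_subset)
    moreover have "x \<in> Z" using p by (simp add: Z_def)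
    ultimately show "x \<in> \<sigma> ` Qbar" "\<sigma> x \<in> Qbar" using ZQ by blast+
  qed
  have "\<sigma> \<in> Gal_Qbar {}"
    unfolding Gal_Qbar_iff
  proof (intro conjI ballI)
    show "bij_betw \<sigma> Qbar Qbar" using inj img unfolding bij_betw_def by blast
    show "\<sigma> 1 = 1" using \<sigma>eq partial_hom_one[OF M(1)] by blast
    fix x y assume "x \<in> Qbar" "y \<in> Qbar"
    then show "\<sigma> (x + y) = \<sigma> x + \<sigma> y" "\<sigma> (x * y) = \<sigma> x * \<sigma> y"
      using \<sigma>eq partial_hom_add[OF M(1) \<sigma>M \<sigma>M] partial_hom_mult[OF M(1) \<sigma>M \<sigma>M] by blast+
  qed simp
  then show ?thesis using M(2) \<sigma>eq by blast
qed

text \<open>The identity of the integers is extended by sending \<open>x\<close> to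
  \<open>y\<close>. This is well defined because every integer polynomial vanishing at
  \<open>x\<close> is a multiple of \<open>f\<close>.\<close>

lemma Gal_Qbar_transitive:
  assumes "Factorial_Ring.irreducible f" "poly (cpoly f) x = 0" "poly (cpoly f) y = 0"
  shows "\<exists>\<sigma>\<in>Gal_Qbar {}. \<sigma> x = y"
proof -
  define R where "R = range (\<lambda>n::int. (complex_of_int n, complex_of_int n))"
  have R: "partial_hom R"
    unfolding partial_hom_def R_def
  proof (intro conjI allI impI)
    show "(1, 1) \<in> range (\<lambda>n::int. (complex_of_int n, complex_of_int n))"
      by (rule range_eqI[of _ _ 1]) simp
    fix x y u v assume "(x, y) \<in> range (\<lambda>n::int. (complex_of_int n, complex_of_int n))"
      "(u, v) \<in> range (\<lambda>n::int. (complex_of_int n, complex_of_int n))"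
    then obtain m n where "x = of_int m" "y = of_int m" "u = of_int n" "v = of_int n" by auto
    then show "(x - u, y - v) \<in> range (\<lambda>n::int. (complex_of_int n, complex_of_int n))"
      "(x * u, y * v) \<in> range (\<lambda>n::int. (complex_of_int n, complex_of_int n))"
      by (auto intro: range_eqI[of _ _ "m - n"] range_eqI[of _ _ "m * n"])
  qed (auto intro: rat_imp_algebraic)
  have "f \<noteq> 0" using assms(1) by auto
  then have x: "algebraic x" unfolding algebraic_cpoly using assms(2) by blast
  have "partial_hom (adjoin R x y)"
  proof (rule partial_hom_adjoin[OF R x])
    fix p q assume pq: "(p, q) \<in> coeff_pairs R" "poly p x = 0"
    have i: "coeff p i \<in> \<int> \<and> coeff p i = coeff q i" for i
    proof -
      have "(coeff p i, coeff q i) \<in> R" using pq(1) by (simp add: coeff_pairs_def)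
      then show ?thesis by (auto simp: R_def)
    qed
    then have "\<forall>i. coeff p i \<in> \<int>" by blast
    have "p = q" by (rule poly_eqI) (use i in blast)
    obtain r where "p = cpoly r" using \<open>\<forall>i. coeff p i \<in> \<int>\<close> cpoly_iff_coeff_Ints by blast
    moreover from this obtain s where "r = f * s"
      using irreducible_root_dvd[OF assms(1,2)] pq(2) by blast
    ultimately show "poly q y = 0" using assms(3) \<open>p = q\<close> by (simp add: hom_distribs)
  qed
  from partial_hom_Gal_Qbar[OF this] obtain \<sigma>
    where "\<sigma> \<in> Gal_Qbar {}" "\<forall>(u, v)\<in>adjoin R x y. \<sigma> u = v" by blast
  with adjoin_contains[OF R, of x y] show ?thesis by auto
qed


section \<open>Counting conjugates\<close>

abbreviation GQ :: "(complex \<Rightarrow> complex) set" where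
  "GQ \<equiv> Gal_Qbar {}"

lemma GQ_Qbar: "\<sigma> \<in> GQ \<Longrightarrow> x \<in> Qbar \<Longrightarrow> \<sigma> x \<in> Qbar"
  unfolding Gal_Qbar_iff by (blast dest: bij_betw_apply)

lemma GQ_hom:
  assumes "\<sigma> \<in> GQ" "x \<in> Qbar" "y \<in> Qbar"
  shows "\<sigma> (x + y) = \<sigma> x + \<sigma> y" "\<sigma> (x * y) = \<sigma> x * \<sigma> y"
  using assms unfolding Gal_Qbar_iff by blast+

lemma GQ_one: "\<sigma> \<in> GQ \<Longrightarrow> \<sigma> 1 = 1"
  unfolding Gal_Qbar_iff by blast

lemma GQ_inj: "\<sigma> \<in> GQ \<Longrightarrow> inj_on \<sigma> Qbar"
  unfolding Gal_Qbar_iff bij_betw_def by blast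

lemma GQ_zero: "\<sigma> \<in> GQ \<Longrightarrow> \<sigma> 0 = 0"
  using GQ_hom(1)[of \<sigma> 0 0] Qbar_closed by simp

lemma GQ_eq_0_iff: "\<sigma> \<in> GQ \<Longrightarrow> x \<in> Qbar \<Longrightarrow> \<sigma> x = 0 \<longleftrightarrow> x = 0"
  using GQ_inj[of \<sigma>] GQ_zero[of \<sigma>] Qbar_closed(9) by (metis inj_onD)

lemma GQ_uminus: "\<sigma> \<in> GQ \<Longrightarrow> x \<in> Qbar \<Longrightarrow> \<sigma> (- x) = - \<sigma> x"
  using GQ_hom(1)[of \<sigma> x "- x"] GQ_zero[of \<sigma>] Qbar_closed(4)[of x]
  by (simp add: eq_neg_iff_add_eq_0 add.commute)

lemma GQ_diff: "\<sigma> \<in> GQ \<Longrightarrow> x \<in> Qbar \<Longrightarrow> y \<in> Qbar \<Longrightarrow> \<sigma> (x - y) = \<sigma> x - \<sigma> y"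
  using GQ_hom(1)[of \<sigma> x "- y"] GQ_uminus[of \<sigma> y] Qbar_closed(4) by simp

lemma GQ_inverse: "\<sigma> \<in> GQ \<Longrightarrow> x \<in> Qbar \<Longrightarrow> \<sigma> (inverse x) = inverse (\<sigma> x)"
proof (cases "x = 0")
  case False
  assume \<sigma>: "\<sigma> \<in> GQ" and x: "x \<in> Qbar"
  have "\<sigma> x * \<sigma> (inverse x) = 1"
    using GQ_hom(2)[OF \<sigma> x Qbar_closed(5)[OF x]] GQ_one[OF \<sigma>] False by simp
  then show ?thesis by (metis inverse_unique)
qed (simp add: GQ_zero)

lemma GQ_prod:
  assumes "\<sigma> \<in> GQ" "\<And>i. i \<in> I \<Longrightarrow> f i \<in> Qbar"
  shows "prod f I \<in> Qbar \<and> \<sigma> (prod f I) = (\<Prod>i\<in>I. \<sigma> (f i))"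
  using assms(2)
  by (induction I rule: infinite_finite_induct)
     (auto simp: GQ_one[OF assms(1)] GQ_hom(2)[OF assms(1)] Qbar_closed)

text \<open>Makes the facts on partial homomorphisms available for automorphisms, in particular
  compatibility with the evaluation of polynomials.\<close>

lemma GQ_graph: "\<sigma> \<in> GQ \<Longrightarrow> partial_hom {(x, \<sigma> x) |x. x \<in> Qbar}"
  unfolding partial_hom_def
  by (auto simp: GQ_one GQ_zero Qbar_closed GQ_diff GQ_hom) (simp add: Qbar_def)

lemma GQ_poly: "\<sigma> \<in> GQ \<Longrightarrow> x \<in> Qbar \<Longrightarrow> poly (cpoly p) (\<sigma> x) = \<sigma> (poly (cpoly p) x)"
  using partial_hom_poly[OF GQ_graph coeff_pairs_cpoly[OF GQ_graph], of \<sigma> x "\<sigma> x" p] by auto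

lemma GQ_root: "\<sigma> \<in> GQ \<Longrightarrow> x \<in> Qbar \<Longrightarrow> poly (cpoly p) x = 0 \<Longrightarrow> poly (cpoly p) (\<sigma> x) = 0"
  by (simp add: GQ_poly GQ_zero)

lemma GQ_of_int: "\<sigma> \<in> GQ \<Longrightarrow> \<sigma> (of_int n) = of_int n"
  using GQ_poly[of \<sigma> 0 "[:n:]"] by (simp add: GQ_zero Qbar_closed hom_distribs)

lemma GQ_comp: "\<sigma> \<in> GQ \<Longrightarrow> \<tau> \<in> GQ \<Longrightarrow> \<sigma> \<circ> \<tau> \<in> GQ"
  unfolding Gal_Qbar_iff[of "\<sigma> \<circ> \<tau>"]
  by (auto simp: GQ_one GQ_hom GQ_Qbar) (auto simp: Gal_Qbar_iff intro: bij_betw_trans)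

lemma GQ_cnj: "cnj \<in> GQ"
proof -
  have "bij_betw cnj Qbar Qbar"
    by (rule bij_betw_byWitness[where f' = cnj]) (auto simp: Qbar_closed)
  then show ?thesis by (simp add: Gal_Qbar_iff)
qed

lemma GQ_inv:
  assumes "\<sigma> \<in> GQ"
  obtains \<rho> where "\<rho> \<in> GQ" "\<And>x. x \<in> Qbar \<Longrightarrow> \<sigma> (\<rho> x) = x" "\<And>x. x \<in> Qbar \<Longrightarrow> \<rho> (\<sigma> x) = x"
proof -
  define \<rho> where "\<rho> = the_inv_into Qbar \<sigma>"
  have bij: "bij_betw \<sigma> Qbar Qbar" using assms unfolding Gal_Qbar_iff by blast
  then have 1: "\<sigma> (\<rho> x) = x" "\<rho> (\<sigma> x) = x" "\<rho> x \<in> Qbar" if "x \<in> Qbar" for x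
    using that bij_betw_the_inv_into[OF bij] unfolding \<rho>_def bij_betw_def
    by (auto simp: f_the_inv_into_f the_inv_into_f_f)
  have e: "\<rho> z = w" if "w \<in> Qbar" "\<sigma> w = z" for w z
    using 1(2)[OF that(1)] that(2) by simp
  have "\<rho> \<in> GQ"
    unfolding Gal_Qbar_iff
  proof (intro conjI ballI)
    show "bij_betw \<rho> Qbar Qbar" unfolding \<rho>_def by (rule bij_betw_the_inv_into[OF bij])
    show "\<rho> 1 = 1" by (rule e) (simp_all add: Qbar_closed GQ_one[OF assms])
    fix x y assume "x \<in> Qbar" "y \<in> Qbar"
    then show "\<rho> (x + y) = \<rho> x + \<rho> y" "\<rho> (x * y) = \<rho> x * \<rho> y"
      by (auto intro!: e simp: Qbar_closed 1 GQ_hom[OF assms])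
  qed simp
  then show thesis using that 1 by blast
qed

text \<open>By transitivity the minimal polynomial has no root besides \<open>z\<close>; its roots
  being simple, it is linear.\<close>

lemma rational_if_GQ_fixed:
  assumes "z \<in> Qbar" "\<And>\<sigma>. \<sigma> \<in> GQ \<Longrightarrow> \<sigma> z = z"
  shows "z \<in> \<rat>"
proof -
  have z: "algebraic z" using assms(1) by (simp add: Qbar_def)
  define f where "f = min_int_poly z"
  note f = min_int_poly[OF z, folded f_def] min_int_poly_degree_pos[OF z, folded f_def]
  have "{w. poly (cpoly f) w = 0} = {z}"
    using Gal_Qbar_transitive[OF f(1,3)] assms(2) f(3) by auto
  then have "degree f = 1" using irreducible_decompose(2)[OF f(1,4)] by simp
  then have "coeff f (Suc (Suc i)) = 0" for i by (simp add: coeff_eq_0)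
  then have "f = [:coeff f 0, coeff f 1:]"
    by (intro poly_eqI) (auto simp: coeff_pCons split: nat.splits)
  then obtain a b where ab: "f = [:b, a:]" "a \<noteq> 0"
    using \<open>degree f = 1\<close> by (metis degree_pCons_0 zero_neq_one pCons_0_0)
  then have "z = - of_int b / of_int a"
    using f(3) by (simp add: hom_distribs field_simps eq_neg_iff_add_eq_0)
  then show ?thesis by simp
qed

context
  fixes W :: "complex set"
  assumes fin: "finite W" and WQ: "W \<subseteq> Qbar" and GQ_W: "\<forall>\<sigma>\<in>GQ. \<forall>x\<in>W. \<sigma> x \<in> W"
begin

lemma GW_closed: "\<sigma> \<in> GQ \<Longrightarrow> x \<in> W \<Longrightarrow> \<sigma> x \<in> W"
  using GQ_W by blast

text \<open>Restriction to \<open>W\<close> turns the Galois group into a finite group, over which one can sum.\<close>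

definition GW :: "(complex \<Rightarrow> complex) set" where
  "GW = (\<lambda>\<sigma>. restrict \<sigma> W) ` GQ"

text \<open>Left translation by \<rho>. Restricting again to \<open>W\<close> keeps the
  representatives canonical, so that equality on \<open>W\<close> is equality of functions.\<close>

definition lmult :: "(complex \<Rightarrow> complex) \<Rightarrow> (complex \<Rightarrow> complex) \<Rightarrow> complex \<Rightarrow> complex" where
  "lmult \<rho> h = restrict (\<rho> \<circ> h) W"

lemma finite_GW: "finite GW"
proof (rule finite_subset)
  show "GW \<subseteq> W \<rightarrow>\<^sub>E W" unfolding GW_def using GW_closed by auto
  show "finite (W \<rightarrow>\<^sub>E W)" using fin by (intro finite_PiE) auto
qed

lemma GW_ne: "id \<in> GQ" "restrict id W \<in> GW"
proof -
  show "id \<in> GQ" by (simp add: Gal_Qbar_iff)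
  then show "restrict id W \<in> GW" by (simp add: GW_def)
qed

lemma card_GW_pos: "card GW > 0"
  using finite_GW GW_ne card_gt_0_iff by blast

lemma lmult_in: "\<rho> \<in> GQ \<Longrightarrow> h \<in> GW \<Longrightarrow> lmult \<rho> h \<in> GW"
proof -
  assume \<rho>: "\<rho> \<in> GQ" and "h \<in> GW"
  then obtain \<sigma> where \<sigma>: "\<sigma> \<in> GQ" "h = restrict \<sigma> W" by (auto simp: GW_def)
  have "lmult \<rho> h = restrict (\<rho> \<circ> \<sigma>) W" unfolding lmult_def \<sigma> by (auto simp: restrict_def)
  then show ?thesis unfolding GW_def using GQ_comp[OF \<rho> \<sigma>(1)] by blast
qed

lemma GW_W: "h \<in> GW \<Longrightarrow> x \<in> W \<Longrightarrow> h x \<in> W"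
  using GW_closed by (auto simp: GW_def)

lemma lmult_inj: "\<rho> \<in> GQ \<Longrightarrow> inj_on (lmult \<rho>) GW"
proof (rule inj_onI)
  fix g h assume \<rho>: "\<rho> \<in> GQ" and gh: "g \<in> GW" "h \<in> GW" "lmult \<rho> g = lmult \<rho> h"
  have "g x = h x" for x
  proof (cases "x \<in> W")
    case True
    then have "\<rho> (g x) = \<rho> (h x)" using fun_cong[OF gh(3), of x] by (simp add: lmult_def)
    moreover have "g x \<in> Qbar" "h x \<in> Qbar" using GW_W gh True WQ by blast+
    ultimately show ?thesis using GQ_inj[OF \<rho>] by (blast dest: inj_onD)
  next
    case False
    then show ?thesis using gh by (auto simp: GW_def)
  qed
  then show "g = h" by blast
qed

lemma lmult_bij: "\<rho> \<in> GQ \<Longrightarrow> bij_betw (lmult \<rho>) GW GW"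
  using lmult_inj lmult_in finite_GW by (intro bij_betw_imageI endo_inj_surj) auto

lemma card_fiber_le:
  assumes "\<rho> \<in> GQ" "Y \<subseteq> W"
  shows "card {h \<in> GW. \<forall>y\<in>Y. h y = g y} \<le> card {h \<in> GW. \<forall>y\<in>Y. h y = \<rho> (g y)}"
proof (rule card_inj_on_le)
  show "inj_on (lmult \<rho>) {h \<in> GW. \<forall>y\<in>Y. h y = g y}"
    by (rule inj_on_subset[OF lmult_inj[OF assms(1)]]) blast
  show "lmult \<rho> ` {h \<in> GW. \<forall>y\<in>Y. h y = g y} \<subseteq> {h \<in> GW. \<forall>y\<in>Y. h y = \<rho> (g y)}"
    using lmult_in[OF assms(1)] assms(2) by (auto simp: lmult_def subset_iff)
qed (simp add: finite_GW)

text \<open>The fibres of restriction to \<open>Y\<close> are cosets of the pointwise stabiliser of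
  \<open>Y\<close>, hence equally large.\<close>

lemma card_fiber_eq:
  assumes "\<sigma> \<in> GQ" "Y \<subseteq> W"
  shows "card {h \<in> GW. \<forall>y\<in>Y. h y = \<sigma> y} = card {h \<in> GW. \<forall>y\<in>Y. h y = y}"
proof (rule antisym)
  obtain \<rho> where \<rho>: "\<rho> \<in> GQ" "\<And>x. x \<in> Qbar \<Longrightarrow> \<rho> (\<sigma> x) = x" using GQ_inv[OF assms(1)] by metis
  have "\<rho> (\<sigma> y) = y" if "y \<in> Y" for y using that \<rho>(2) assms(2) WQ by blast
  then show "card {h \<in> GW. \<forall>y\<in>Y. h y = \<sigma> y} \<le> card {h \<in> GW. \<forall>y\<in>Y. h y = y}"
    using card_fiber_le[OF \<rho>(1) assms(2), of \<sigma>] by (simp cong: conj_cong)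
  show "card {h \<in> GW. \<forall>y\<in>Y. h y = y} \<le> card {h \<in> GW. \<forall>y\<in>Y. h y = \<sigma> y}"
    using card_fiber_le[OF assms, of "\<lambda>y. y"] .
qed

text \<open>Restriction to \<open>S\<close> has fibres of equal size, and at most
  \<open>fact (card S)\<close> of them, since every restriction permutes the stable set
  \<open>S\<close>.\<close>

lemma card_GW_le:
  assumes "\<sigma> \<in> GQ" "S \<subseteq> W" "\<And>\<sigma> x. \<sigma> \<in> GQ \<Longrightarrow> x \<in> S \<Longrightarrow> \<sigma> x \<in> S"
  shows "card GW \<le> fact (card S) * card {h \<in> GW. \<forall>y\<in>S. h y = \<sigma> y}"
proof -
  define c where "c = card {h \<in> GW. \<forall>y\<in>S. h y = y}"
  \<comment> \<open>Extension by the identity outside \<open>S\<close> matches the convention of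
    \<open>permutes\<close>.\<close>
  define r where "r h = (\<lambda>x. if x \<in> S then h x else x)" for h :: "complex \<Rightarrow> complex"
  have finS: "finite S" using assms(2) fin finite_subset by blast
  have perm: "r h permutes S" if h: "h \<in> GW" for h
  proof -
    obtain \<rho> where \<rho>: "\<rho> \<in> GQ" "h = restrict \<rho> W" using h by (auto simp: GW_def)
    have e: "r h x = \<rho> x" if "x \<in> S" for x using that assms(2) \<rho>(2) by (auto simp: r_def)
    have "inj_on \<rho> S" using GQ_inj[OF \<rho>(1)] assms(2) WQ by (meson inj_on_subset order_trans)
    then have "inj_on (r h) S" using e by (simp cong: inj_on_cong)
    moreover have "r h ` S \<subseteq> S" using e assms(3)[OF \<rho>(1)] by auto
    ultimately have "bij_betw (r h) S S" using finS by (intro bij_betw_imageI endo_inj_surj)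
    then show ?thesis by (rule bij_imp_permutes) (simp add: r_def)
  qed
  have "card GW = (\<Sum>p\<in>r ` GW. card {h \<in> GW. r h = p})"
    using finite_GW by (simp add: card_eq_sum sum.group del: sum_constant)
  also have "\<dots> = (\<Sum>p\<in>r ` GW. c)"
  proof (rule sum.cong)
    fix p assume "p \<in> r ` GW"
    then obtain \<rho> where \<rho>: "\<rho> \<in> GQ" "p = r (restrict \<rho> W)" by (auto simp: GW_def)
    have "r h = p \<longleftrightarrow> (\<forall>y\<in>S. h y = \<rho> y)" for h
      using assms(2) by (auto simp: \<rho> r_def fun_eq_iff subset_iff)
    then show "card {h \<in> GW. r h = p} = c" using card_fiber_eq[OF \<rho>(1) assms(2)] by (simp add: c_def)
  qed simp
  also have "\<dots> = card (r ` GW) * c" by simp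
  also have "card (r ` GW) \<le> card {p. p permutes S}"
    using perm finS by (intro card_mono finite_permutations) auto
  also have "card {p. p permutes S} = fact (card S)" by (rule card_permutations[OF refl finS])
  finally have "card GW \<le> fact (card S) * c" by simp
  then show ?thesis using card_fiber_eq[OF assms(1,2)] by (simp add: c_def)
qed

section \<open>Orbits of the roots of an irreducible polynomial\<close>

context
  fixes f :: "int poly"
  assumes irr: "Factorial_Ring.irreducible f" and deg: "degree f > 0"
    and ZW: "{z. poly (cpoly f) z = 0} \<subseteq> W"
begin

text \<open>The number of elements of \<open>GW\<close> that take one given root to another. The
  division is exact by orbit counting, see \<open>card_GW_eq\<close>.\<close>

definition fiber_size where "fiber_size = card GW div degree f"

lemma GW_root: "h \<in> GW \<Longrightarrow> poly (cpoly f) x = 0 \<Longrightarrow> poly (cpoly f) (h x) = 0"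
proof -
  assume h: "h \<in> GW" and x: "poly (cpoly f) x = 0"
  then have "x \<in> W" using ZW by blast
  then show ?thesis using GQ_root[OF _ _ x] h WQ by (auto simp: GW_def)
qed

text \<open>Transitivity on the roots makes all these fibres cosets of the stabiliser of
  \<open>x\<close>, and their \<open>degree f\<close> equal sizes add up to
  \<open>card GW\<close>.\<close>

lemma card_root_fiber:
  assumes "poly (cpoly f) x = 0" "poly (cpoly f) z = 0"
  shows "card {h \<in> GW. h x = z} = fiber_size"
proof -
  define Z where "Z = {z. poly (cpoly f) z = 0}"
  have xW: "x \<in> W" using assms ZW by blast
  have fib: "card {h \<in> GW. h x = z} = card {h \<in> GW. h x = x}" if "z \<in> Z" for z
  proof -
    obtain \<sigma> where "\<sigma> \<in> GQ" "\<sigma> x = z"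
      using Gal_Qbar_transitive[OF irr assms(1)] \<open>z \<in> Z\<close> by (auto simp: Z_def)
    then show ?thesis using card_fiber_eq[of \<sigma> "{x}"] xW by simp
  qed
  have Z: "finite Z" "card Z = degree f"
    using irreducible_decompose[OF irr deg] by (simp_all add: Z_def)
  have img: "(\<lambda>h. h x) ` GW \<subseteq> Z"
    using GW_root[OF _ assms(1)] by (auto simp: Z_def)
  have "card GW = (\<Sum>z\<in>Z. card {h \<in> GW. h x = z})"
    using sum.group[OF finite_GW Z(1) img, of "\<lambda>_. 1::nat"] by (simp add: card_eq_sum del: sum_constant)
  also have "\<dots> = degree f * card {h \<in> GW. h x = x}" using fib Z by simp
  finally show ?thesis using fib[of z] assms(2) deg by (simp add: fiber_size_def Z_def)
qed

lemma card_GW_eq: "card GW = fiber_size * degree f"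
  and sum_GW: "poly (cpoly f) x = 0 \<Longrightarrow> (\<Sum>h\<in>GW. g (h x)) = real fiber_size * (\<Sum>z | poly (cpoly f) z = 0. g z)"
proof -
  define Z where "Z = {z. poly (cpoly f) z = 0}"
  have Z: "finite Z" "card Z = degree f"
    using irreducible_decompose[OF irr deg] by (simp_all add: Z_def)
  have main: "(\<Sum>h\<in>GW. g (h x)) = real fiber_size * (\<Sum>z\<in>Z. g z)" if x: "poly (cpoly f) x = 0" for g x
  proof -
    have img: "(\<lambda>h. h x) ` GW \<subseteq> Z"
      using GW_root[OF _ x] by (auto simp: Z_def)
    have "(\<Sum>h\<in>GW. g (h x)) = (\<Sum>z\<in>Z. \<Sum>h\<in>{h \<in> GW. h x = z}. g (h x))"
      using sum.group[OF finite_GW Z(1) img, of "\<lambda>h. g (h x)"] by simp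
    also have "\<dots> = (\<Sum>z\<in>Z. real fiber_size * g z)"
    proof (rule sum.cong[OF refl])
      fix z assume "z \<in> Z"
      then have "card {h \<in> GW. h x = z} = fiber_size" using card_root_fiber[OF x] by (simp add: Z_def)
      then show "(\<Sum>h\<in>{h \<in> GW. h x = z}. g (h x)) = real fiber_size * g z" by simp
    qed
    finally show ?thesis by (simp add: sum_distrib_left)
  qed
  show "poly (cpoly f) x = 0 \<Longrightarrow> (\<Sum>h\<in>GW. g (h x)) = real fiber_size * (\<Sum>z | poly (cpoly f) z = 0. g z)"
    using main by (simp add: Z_def)
  obtain x where "x \<in> Z" using Z deg by fastforce
  then have "real (card GW) = real (fiber_size * degree f)"
    using main[of x "\<lambda>_. 1"] Z by (simp add: Z_def)
  then show "card GW = fiber_size * degree f" by (simp only: of_nat_eq_iff)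
qed

text \<open>Every root occurs at most \<open>fiber_size\<close> times in the product, which therefore splits into
  \<open>fiber_size\<close> products of distinct roots.\<close>

lemma algebraic_int_prod_subset:
  assumes "poly (cpoly f) x = 0" "T \<subseteq> GW"
  shows "algebraic_int (of_int (lead_coeff f) ^ fiber_size * (\<Prod>h\<in>T. h x))"
proof -
  define Z where "Z = {z. poly (cpoly f) z = 0}"
  define a where "a = (of_int (lead_coeff f) :: complex)"
  note dec = irreducible_decompose[OF irr deg, folded Z_def]
  have finT: "finite T" using assms(2) finite_GW finite_subset by blast
  define e where "e z = card {h \<in> T. h x = z}" for z
  have e: "e z \<le> fiber_size" if "z \<in> Z" for z
  proof -
    have "e z \<le> card {h \<in> GW. h x = z}" unfolding e_def
      using assms(2) finite_GW by (intro card_mono) auto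
    also have "\<dots> = fiber_size" using card_root_fiber[OF assms(1)] that by (simp add: Z_def)
    finally show ?thesis .
  qed
  have img: "(\<lambda>h. h x) ` T \<subseteq> Z"
    using GW_root[OF _ assms(1)] assms(2) by (auto simp: Z_def)
  have "(\<Prod>h\<in>T. h x) = (\<Prod>z\<in>Z. \<Prod>h\<in>{h \<in> T. h x = z}. h x)"
    using prod.group[OF finT dec(3) img, of "\<lambda>h. h x"] by simp
  also have "\<dots> = (\<Prod>z\<in>Z. z ^ e z)" by (intro prod.cong) (simp_all add: e_def)
  also have "\<dots> = (\<Prod>z\<in>Z. \<Prod>j<fiber_size. if j < e z then z else 1)"
  proof (rule prod.cong[OF refl])
    fix z assume "z \<in> Z"
    then have "{..<fiber_size} \<inter> {j. j < e z} = {..<e z}" using e by fastforce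
    then show "z ^ e z = (\<Prod>j<fiber_size. if j < e z then z else 1)" by (simp add: prod.If_cases)
  qed
  also have "\<dots> = (\<Prod>j<fiber_size. \<Prod>z\<in>Z. if j < e z then z else 1)" by (rule prod.swap)
  also have "\<dots> = (\<Prod>j<fiber_size. \<Prod>{z\<in>Z. j < e z})"
  proof (rule prod.cong[OF refl])
    show "(\<Prod>z\<in>Z. if j < e z then z else 1) = \<Prod>{z\<in>Z. j < e z}" for j
      using prod.inter_filter[OF dec(3), of "\<lambda>z. z" "\<lambda>z. j < e z"] by simp
  qed
  finally have "a ^ fiber_size * (\<Prod>h\<in>T. h x) = (\<Prod>j<fiber_size. a * \<Prod>{z\<in>Z. j < e z})"
    by (simp add: prod.distrib)
  moreover have "algebraic_int (a * \<Prod>{z\<in>Z. j < e z})" for j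
  proof (rule algebraic_int_lead_coeff_prod_roots[OF _ dec(3)])
    show "algebraic_int (coeff (smult a (\<Prod>z\<in>Z. [:-z, 1:])) i)" for i
      unfolding a_def dec(1)[symmetric] by (rule int_imp_algebraic_int) simp
  qed blast
  ultimately show ?thesis by (simp add: a_def algebraic_int_prod)
qed

text \<open>Expanding the product over subsets \<open>T\<close> separates the conjugates of
  \<open>x\<close> from those of \<open>y\<close>; each of the two products is cleared by
  \<open>fiber_size\<close> factors of the leading coefficient, hence the exponent. Left
  translations permute the factors of the full product, so the resulting algebraic integer is
  rational.\<close>

lemma norm_prod_ge_1:
  assumes x: "poly (cpoly f) x = 0" and y: "poly (cpoly f) y = 0" and xy: "x * y \<noteq> 1"
  shows "cmod (of_int (lead_coeff f) ^ (2 * fiber_size) * (\<Prod>h\<in>GW. h x * h y - 1)) \<ge> 1"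
proof -
  define a where "a = (of_int (lead_coeff f) :: complex)"
  define P where "P = (\<Prod>h\<in>GW. h x * h y - 1)"
  have xyW: "x \<in> W" "y \<in> W" using x y ZW by auto
  have Q: "h x \<in> Qbar" "h y \<in> Qbar" "h x * h y - 1 \<in> Qbar" if "h \<in> GW" for h
    using GW_W[OF that] xyW WQ by (auto intro!: Qbar_closed)
  have a0: "a \<noteq> 0" using irr by (auto simp: a_def)
  have "h x * h y - 1 \<noteq> 0" if h: "h \<in> GW" for h
  proof -
    obtain \<sigma> where \<sigma>: "\<sigma> \<in> GQ" "h = restrict \<sigma> W" using h by (auto simp: GW_def)
    have q: "x \<in> Qbar" "y \<in> Qbar" using xyW WQ by auto
    have "h x * h y - 1 = \<sigma> (x * y - 1)"
      using GQ_diff[OF \<sigma>(1), of "x * y" 1] q xyW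
      by (simp add: \<sigma> GQ_hom[OF \<sigma>(1)] GQ_one[OF \<sigma>(1)] Qbar_closed)
    then show ?thesis using GQ_eq_0_iff[OF \<sigma>(1), of "x * y - 1"] q xy by (simp add: Qbar_closed)
  qed
  then have ne: "a ^ (2 * fiber_size) * P \<noteq> 0" using a0 finite_GW by (simp add: P_def)
  have "P = (\<Sum>T\<in>Pow GW. (\<Prod>h\<in>T. h x * h y) * (\<Prod>h\<in>GW - T. - 1))"
    using prod_add[OF finite_GW, of "\<lambda>h. h x * h y" "\<lambda>_. - 1"] by (simp add: P_def)
  then have "a ^ (2 * fiber_size) * P = (\<Sum>T\<in>Pow GW. (a ^ fiber_size * (\<Prod>h\<in>T. h x)) * (a ^ fiber_size * (\<Prod>h\<in>T. h y)) * (- 1) ^ card (GW - T))"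
    by (simp only: mult_2 power_add sum_distrib_left prod.distrib prod_constant mult_ac)
  also have "algebraic_int \<dots>"
  proof (rule algebraic_int_sum)
    fix T assume "T \<in> Pow GW"
    then have T: "T \<subseteq> GW" by blast
    have s: "algebraic_int ((- 1 :: complex) ^ n)" for n by (rule int_imp_algebraic_int) simp
    show "algebraic_int ((a ^ fiber_size * (\<Prod>h\<in>T. h x)) * (a ^ fiber_size * (\<Prod>h\<in>T. h y)) * (- 1) ^ card (GW - T))"
      unfolding a_def
      by (rule algebraic_int_mult[OF algebraic_int_mult[OF algebraic_int_prod_subset[OF x T]
            algebraic_int_prod_subset[OF y T]] s])
  qed
  finally have ai: "algebraic_int (a ^ (2 * fiber_size) * P)" .
  moreover have "a ^ (2 * fiber_size) * P \<in> \<rat>"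
  proof (rule rational_if_GQ_fixed)
    show "a ^ (2 * fiber_size) * P \<in> Qbar" using ai by (auto simp: Qbar_def)
    fix \<sigma> assume \<sigma>: "\<sigma> \<in> GQ"
    have "P \<in> Qbar \<and> \<sigma> P = (\<Prod>h\<in>GW. \<sigma> (h x * h y - 1))"
      unfolding P_def by (rule GQ_prod[OF \<sigma> Q(3)])
    then have PQ: "P \<in> Qbar" and "\<sigma> P = (\<Prod>h\<in>GW. \<sigma> (h x * h y - 1))" by simp_all
    note this(2)
    also have "\<dots> = (\<Prod>h\<in>GW. lmult \<sigma> h x * lmult \<sigma> h y - 1)"
      using xyW by (intro prod.cong refl)
        (simp add: lmult_def GQ_diff[OF \<sigma>] GQ_hom[OF \<sigma>] GQ_one[OF \<sigma>] Q Qbar_closed)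
    also have "\<dots> = P" unfolding P_def by (rule prod.reindex_bij_betw[OF lmult_bij[OF \<sigma>]])
    finally have "\<sigma> P = P" .
    moreover have "a ^ (2 * fiber_size) = of_int (lead_coeff f ^ (2 * fiber_size))" by (simp add: a_def)
    ultimately show "\<sigma> (a ^ (2 * fiber_size) * P) = a ^ (2 * fiber_size) * P"
      by (simp only: GQ_of_int[OF \<sigma>] GQ_hom(2)[OF \<sigma> Qbar_closed(7) PQ])
  qed
  ultimately have "a ^ (2 * fiber_size) * P \<in> \<int>" by (rule rational_algebraic_int_is_int)
  then obtain n where n: "a ^ (2 * fiber_size) * P = of_int n" by (auto elim: Ints_cases)
  then have "n \<noteq> 0" using ne by auto
  then have "1 \<le> \<bar>n\<bar>" by simp
  then have "1 \<le> cmod (of_int n)" by (simp add: norm_of_int)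
  then show ?thesis using n by (simp add: a_def P_def)
qed

end

end


section \<open>The height inequality\<close>

text \<open>The parameter \<open>A\<close> is free: a large value makes the bound strongly negative for \<open>r\<close> near 1.\<close>

lemma log_abs_diff_one_le:
  fixes r A :: real
  assumes "r > 0" "r \<noteq> 1" "A > 0"
  shows "ln \<bar>r\<^sup>2 - 1\<bar> \<le> - ln A + 2 * A * \<bar>ln r\<bar> + 2 * ln (max 1 r)"
proof -
  \<comment> \<open>This is \<open>\<bar>ln (r\<^sup>2)\<bar>\<close>. The inequality
    \<open>ln y \<le> y - 1\<close> at \<open>1 / r\<^sup>2\<close> for \<open>r > 1\<close>, and at
    \<open>r\<^sup>2\<close> otherwise, compares it with
    \<open>\<bar>r\<^sup>2 - 1\<bar>\<close>.\<close>
  define t where "t = 2 * \<bar>ln r\<bar>"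
  have t: "t > 0" using assms by (simp add: t_def)
  have le: "\<bar>r\<^sup>2 - 1\<bar> \<le> (max 1 r)\<^sup>2 * t"
  proof (cases "r > 1")
    case True
    have "ln (1 / r\<^sup>2) \<le> 1 / r\<^sup>2 - 1" using assms by (intro ln_le_minus_one) simp
    then have "r\<^sup>2 * (1 - 1 / r\<^sup>2) \<le> r\<^sup>2 * t"
      using assms True by (intro mult_left_mono) (simp_all add: t_def ln_div ln_realpow)
    moreover have "r\<^sup>2 * (1 - 1 / r\<^sup>2) = \<bar>r\<^sup>2 - 1\<bar>"
      using True assms by (simp add: right_diff_distrib)
    ultimately show ?thesis using True by (simp add: max_def)
  next
    case False
    have "ln (r\<^sup>2) \<le> r\<^sup>2 - 1" using assms by (intro ln_le_minus_one) simp
    moreover have "r\<^sup>2 \<le> 1" using False assms by (simp add: power_le_one)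
    ultimately show ?thesis using False assms by (simp add: t_def max_def ln_realpow)
  qed
  have pos: "\<bar>r\<^sup>2 - 1\<bar> > 0" using assms by (simp add: power2_eq_1_iff)
  have m: "max 1 r > 0" by simp
  have "ln \<bar>r\<^sup>2 - 1\<bar> \<le> ln ((max 1 r)\<^sup>2 * t)" using le pos by simp
  also have "\<dots> = 2 * ln (max 1 r) + ln t" using t m by (simp add: ln_mult_pos ln_realpow)
  \<comment> \<open>Splitting off \<open>ln A\<close> before the crude estimate
    \<open>ln y \<le> y\<close> produces the negative term.\<close>
  also have "ln t = ln (A * t) - ln A" using t assms by (simp add: ln_mult_pos)
  also have "ln (A * t) \<le> A * t" using t assms ln_bound[of "A * t"] by simp
  finally show ?thesis by (simp add: t_def)
qed

text \<open>The quantitative form of the statement that small height keeps most conjugates near the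
  unit circle. Each \<open>\<bar>ln (cmod z)\<bar>\<close> is
  \<open>2 * ln (max 1 (cmod z)) - ln (cmod z)\<close>, and the sum of the subtracted terms is at
  least \<open>- ln (lead_coeff f)\<close> because the constant coefficient of \<open>f\<close> is a
  nonzero integer.\<close>

lemma sum_abs_ln_roots_le:
  assumes \<alpha>: "\<alpha> \<in> Qbar" "\<alpha> \<noteq> 0"
  defines "f \<equiv> min_int_poly \<alpha>"
  shows "(\<Sum>z | poly (cpoly f) z = 0. \<bar>ln (cmod z)\<bar>) \<le> 2 * (degree f * weil_height \<alpha>)"
proof -
  define Z where "Z = {z. poly (cpoly f) z = 0}"
  have alg: "algebraic \<alpha>" using \<alpha> by (simp add: Qbar_def)
  note f = min_int_poly[OF alg, folded f_def] min_int_poly_degree_pos[OF alg, folded f_def]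
  note dec = irreducible_decompose[OF f(1,4), folded Z_def]
  have z0: "z \<noteq> 0" if z: "z \<in> Z" for z
  proof
    assume "z = 0"
    then obtain \<sigma> where "\<sigma> \<in> GQ" "\<sigma> \<alpha> = 0"
      using Gal_Qbar_transitive[OF f(1,3), of 0] z by (auto simp: Z_def)
    then show False using GQ_eq_0_iff \<alpha> by blast
  qed
  have "of_int (coeff f 0) = poly (cpoly f) 0" by (simp add: poly_0_coeff_0)
  also have "\<dots> = of_int (lead_coeff f) * (\<Prod>z\<in>Z. - z)" unfolding dec(1) by (simp add: poly_prod)
  finally have e: "of_int (coeff f 0) = of_int (lead_coeff f) * (\<Prod>z\<in>Z. - z)" .
  then have "coeff f 0 \<noteq> 0" using f(2) z0 dec(3) by auto
  then have "1 \<le> \<bar>coeff f 0\<bar>" by simp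
  then have "1 \<le> cmod (of_int (coeff f 0))" by (simp add: norm_of_int)
  also have "\<dots> = of_int (lead_coeff f) * (\<Prod>z\<in>Z. cmod z)"
    unfolding e using f(2) by (simp add: norm_mult prod_norm[symmetric])
  finally have ge: "1 \<le> of_int (lead_coeff f) * (\<Prod>z\<in>Z. cmod z)" .
  have pos: "(\<Prod>z\<in>Z. cmod z) > 0" using z0 by (intro prod_pos) simp
  have "0 \<le> ln (of_int (lead_coeff f) * (\<Prod>z\<in>Z. cmod z))" using ge by simp
  also have "\<dots> = ln (of_int (lead_coeff f)) + (\<Sum>z\<in>Z. ln (cmod z))"
    using f(2) pos z0 dec(3) by (simp add: ln_mult_pos ln_prod)
  finally have 1: "0 \<le> ln (of_int (lead_coeff f)) + (\<Sum>z\<in>Z. ln (cmod z))" .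
  have "\<bar>ln (cmod z)\<bar> = 2 * ln (max 1 (cmod z)) - ln (cmod z)" if "z \<in> Z" for z
    using z0[OF that] by (cases "cmod z \<ge> 1") (simp_all add: max_def)
  then have "(\<Sum>z\<in>Z. \<bar>ln (cmod z)\<bar>) = 2 * (\<Sum>z\<in>Z. ln (max 1 (cmod z))) - (\<Sum>z\<in>Z. ln (cmod z))"
    by (simp add: sum_subtractf sum_distrib_left)
  moreover have "0 \<le> ln (of_int (lead_coeff f) :: real)" using f(2) by simp
  moreover have "degree f * weil_height \<alpha> = ln (of_int (lead_coeff f)) + (\<Sum>z\<in>Z. ln (max 1 (cmod z)))"
    using weil_height_eq[OF alg] by (simp add: f_def Z_def)
  ultimately show ?thesis using 1 by (simp add: Z_def)
qed

text \<open>The fields are absent here: all that the extension contributes is condensed into the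
  assumption \<open>cnj\<close>. The proof takes logarithms in the lower bound for the norm of
  \<alpha> \<tau>(\<alpha>) - 1 and estimates the factors separately for good and for arbitrary
  elements of the finite group.\<close>

lemma weil_height_lower_bound:
  fixes \<alpha> :: complex
  assumes \<alpha>: "\<alpha> \<in> Qbar" "\<alpha> \<noteq> 0"
    and S: "finite S" "S \<subseteq> Qbar" "\<And>\<sigma> x. \<sigma> \<in> GQ \<Longrightarrow> x \<in> S \<Longrightarrow> \<sigma> x \<in> S"
    and \<sigma>0: "\<sigma>\<^sub>0 \<in> GQ" "cmod (\<sigma>\<^sub>0 \<alpha>) \<noteq> 1" and \<tau>: "\<tau> \<in> GQ"
    and cnj: "\<And>\<sigma>. \<sigma> \<in> GQ \<Longrightarrow> (\<And>s. s \<in> S \<Longrightarrow> \<sigma> s = \<sigma>\<^sub>0 s) \<Longrightarrow> cnj (\<sigma> \<alpha>) = \<sigma> (\<tau> \<alpha>)"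
  shows "weil_height \<alpha> \<ge> ln 2 / (2 + 4 * 4 ^ fact (card S))"
proof -
  have alg: "algebraic \<alpha>" using \<alpha> by (simp add: Qbar_def)
  define f where "f = min_int_poly \<alpha>"
  note f = min_int_poly[OF alg, folded f_def] min_int_poly_degree_pos[OF alg, folded f_def]
  define Z where "Z = {z. poly (cpoly f) z = 0}"
  note dec = irreducible_decompose[OF f(1,4), folded Z_def]
  define d where "d = degree f"
  define hh where "hh = weil_height \<alpha>"
  define L where "L z = ln (max 1 (cmod z))" for z
  have f0: "f \<noteq> 0" using f(4) by auto
  have ZQ: "Z \<subseteq> Qbar" unfolding Z_def Qbar_def algebraic_cpoly using f0 by blast
  have Zst: "\<sigma> z \<in> Z" if "\<sigma> \<in> GQ" "z \<in> Z" for \<sigma> z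
    using GQ_root[OF that(1), of z f] that ZQ by (auto simp: Z_def)
  \<comment> \<open>The conjugates of \<alpha> are needed to evaluate the factors, the set
    \<open>S\<close> to recognise the good elements.\<close>
  define W where "W = Z \<union> S"
  have W: "finite W" "W \<subseteq> Qbar" "\<forall>\<sigma>\<in>GQ. \<forall>x\<in>W. \<sigma> x \<in> W"
    using dec(3) S ZQ Zst by (auto simp: W_def)
  have ZW: "{z. poly (cpoly f) z = 0} \<subseteq> W" by (simp add: W_def Z_def)
  define H where "H = GW W"
  define k where "k = fiber_size W f"
  have finH: "finite H" unfolding H_def by (rule finite_GW[OF W])
  have cardH: "card H = k * d" unfolding H_def k_def d_def by (rule card_GW_eq[OF W f(1,4) ZW])
  have Hpos: "card H > 0" unfolding H_def by (rule card_GW_pos[OF W])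
  have sumH: "(\<Sum>h\<in>H. g (h x)) = real k * (\<Sum>z\<in>Z. g z)" if "x \<in> Z" for g x
    unfolding H_def k_def Z_def by (rule sum_GW[OF W f(1,4) ZW]) (use that in \<open>simp add: Z_def\<close>)
  have \<alpha>Z: "\<alpha> \<in> Z" and \<tau>Z: "\<tau> \<alpha> \<in> Z" using f(3) Zst[OF \<tau>] by (auto simp: Z_def)
  have \<tau>Q: "\<tau> \<alpha> \<in> Qbar" using \<tau>Z ZQ by blast
  have ne: "\<alpha> * \<tau> \<alpha> \<noteq> 1"
  proof
    assume "\<alpha> * \<tau> \<alpha> = 1"
    then have "\<sigma>\<^sub>0 \<alpha> * \<sigma>\<^sub>0 (\<tau> \<alpha>) = 1"
      using GQ_hom(2)[OF \<sigma>0(1) \<alpha>(1) \<tau>Q] GQ_one[OF \<sigma>0(1)] by simp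
    then have "\<sigma>\<^sub>0 \<alpha> * cnj (\<sigma>\<^sub>0 \<alpha>) = 1" using cnj[OF \<sigma>0(1)] by simp
    then have "(cmod (\<sigma>\<^sub>0 \<alpha>))\<^sup>2 = 1" by (metis complex_norm_square of_real_eq_1_iff)
    then show False using \<sigma>0(2) power2_eq_iff_nonneg[of "cmod (\<sigma>\<^sub>0 \<alpha>)" 1] by simp
  qed
  define m :: nat where "m = fact (card S)"
  \<comment> \<open>Chosen so that \<open>ln A = 2 * m * ln 2\<close>: gained on a fraction of at
    least \<open>1 / m\<close>, this is twice the loss \<open>ln 2\<close> of the trivial
    bound.\<close>
  define A :: real where "A = 4 ^ m"
  define good where "good = {h \<in> H. \<forall>y\<in>S. h y = \<sigma>\<^sub>0 y}"
  have good: "card H \<le> m * card good"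
    unfolding H_def m_def good_def
    by (rule card_GW_le[OF W \<sigma>0(1)]) (use S(3) in \<open>auto simp: W_def\<close>)
  define u where "u h = ln (cmod (h \<alpha> * h (\<tau> \<alpha>) - 1))" for h :: "complex \<Rightarrow> complex"
  have rep: "\<exists>\<sigma>. \<sigma> \<in> GQ \<and> (\<forall>x\<in>W. h x = \<sigma> x)" if "h \<in> H" for h
    using that unfolding H_def GW_def[OF W] by auto
  have Hne: "h \<alpha> * h (\<tau> \<alpha>) \<noteq> 1" "h \<alpha> \<noteq> 0" if h: "h \<in> H" for h
  proof -
    obtain \<sigma> where \<sigma>: "\<sigma> \<in> GQ" "\<forall>x\<in>W. h x = \<sigma> x" using rep[OF h] by blast
    have e: "h \<alpha> = \<sigma> \<alpha>" "h (\<tau> \<alpha>) = \<sigma> (\<tau> \<alpha>)" using \<sigma>(2) \<alpha>Z \<tau>Z by (auto simp: W_def)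
    have q: "\<alpha> * \<tau> \<alpha> \<in> Qbar" by (intro Qbar_closed \<alpha> \<tau>Q)
    have "\<sigma> (\<alpha> * \<tau> \<alpha>) \<noteq> \<sigma> 1"
      using GQ_inj[OF \<sigma>(1)] q Qbar_closed(8) ne by (metis inj_onD)
    then show "h \<alpha> * h (\<tau> \<alpha>) \<noteq> 1"
      using GQ_hom(2)[OF \<sigma>(1) \<alpha>(1) \<tau>Q] GQ_one[OF \<sigma>(1)] e by simp
    show "h \<alpha> \<noteq> 0" using GQ_eq_0_iff[OF \<sigma>(1) \<alpha>(1)] e \<alpha>(2) by simp
  qed
  have u_le: "u h \<le> ln 2 + L (h \<alpha>) + L (h (\<tau> \<alpha>))" if h: "h \<in> H" for h
  proof -
    define M where "M = max 1 (cmod (h \<alpha>)) * max 1 (cmod (h (\<tau> \<alpha>)))"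
    have "cmod (h \<alpha> * h (\<tau> \<alpha>) - 1) \<le> cmod (h \<alpha>) * cmod (h (\<tau> \<alpha>)) + 1"
      using norm_triangle_ineq4[of "h \<alpha> * h (\<tau> \<alpha>)" 1] by (simp add: norm_mult)
    moreover have "cmod (h \<alpha>) * cmod (h (\<tau> \<alpha>)) \<le> M" unfolding M_def by (intro mult_mono) auto
    moreover have "1 * 1 \<le> M" unfolding M_def by (intro mult_mono) auto
    ultimately have "cmod (h \<alpha> * h (\<tau> \<alpha>) - 1) \<le> 2 * M" by linarith
    moreover have "cmod (h \<alpha> * h (\<tau> \<alpha>) - 1) > 0" using Hne[OF h] by simp
    ultimately have "u h \<le> ln (2 * M)" unfolding u_def by (subst ln_le_cancel_iff) linarith+
    also have "\<dots> = ln 2 + L (h \<alpha>) + L (h (\<tau> \<alpha>))"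
      unfolding M_def L_def by (simp add: ln_mult_pos less_max_iff_disj)
    finally show ?thesis .
  qed
  \<comment> \<open>Stated as the trivial bound plus a correction, so that both bounds combine in
    one sum over \<open>H\<close>. The summand \<open>ln 2\<close> is slack here.\<close>
  have u_good: "u h \<le> ln 2 + L (h \<alpha>) + L (h (\<tau> \<alpha>)) + (2 * A * \<bar>ln (cmod (h \<alpha>))\<bar> - 2 * m * ln 2)"
    if h: "h \<in> good" for h
  proof -
    have hH: "h \<in> H" using h by (simp add: good_def)
    obtain \<sigma> where \<sigma>: "\<sigma> \<in> GQ" "\<forall>x\<in>W. h x = \<sigma> x" using rep[OF hH] by blast
    have e: "h \<alpha> = \<sigma> \<alpha>" "h (\<tau> \<alpha>) = \<sigma> (\<tau> \<alpha>)" using \<sigma>(2) \<alpha>Z \<tau>Z by (auto simp: W_def)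
    have "\<sigma> s = \<sigma>\<^sub>0 s" if "s \<in> S" for s using h \<sigma>(2) that by (auto simp: good_def W_def)
    then have c: "h (\<tau> \<alpha>) = cnj (h \<alpha>)" using cnj[OF \<sigma>(1)] e by simp
    define r where "r = cmod (h \<alpha>)"
    have p: "h \<alpha> * h (\<tau> \<alpha>) = of_real (r\<^sup>2)" unfolding c r_def by (simp only: complex_norm_square)
    have r: "r > 0" "r \<noteq> 1" using Hne[OF hH] p by (auto simp: r_def)
    have "cmod (h \<alpha> * h (\<tau> \<alpha>) - 1) = \<bar>r\<^sup>2 - 1\<bar>" unfolding p by (metis norm_of_real of_real_1 of_real_diff)
    then have "u h \<le> - ln A + 2 * A * \<bar>ln r\<bar> + 2 * ln (max 1 r)"
      unfolding u_def using log_abs_diff_one_le[OF r, of A] by (simp add: A_def)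
    also have "ln A = 2 * m * ln 2"
    proof -
      have "A = 2 ^ (2 * m)" unfolding A_def power_mult by simp
      then show ?thesis by (simp add: ln_realpow)
    qed
    also have "2 * ln (max 1 r) = L (h \<alpha>) + L (h (\<tau> \<alpha>))" unfolding c L_def r_def by simp
    finally have "u h \<le> - (2 * m * ln 2) + 2 * A * \<bar>ln (cmod (h \<alpha>))\<bar> + (L (h \<alpha>) + L (h (\<tau> \<alpha>)))"
      unfolding r_def .
    moreover have "ln 2 > (0::real)" by simp
    ultimately show ?thesis by linarith
  qed
  have P: "1 \<le> cmod (of_int (lead_coeff f) ^ (2 * k) * (\<Prod>h\<in>H. h \<alpha> * h (\<tau> \<alpha>) - 1))"
    unfolding H_def k_def
    by (rule norm_prod_ge_1[OF W f(1,4) ZW]) (use \<alpha>Z \<tau>Z ne in \<open>auto simp: Z_def\<close>)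
  define a where "a = real_of_int (lead_coeff f)"
  have a: "a > 0" using f(2) by (simp add: a_def)
  have "0 \<le> ln (cmod (of_int (lead_coeff f) ^ (2 * k) * (\<Prod>h\<in>H. h \<alpha> * h (\<tau> \<alpha>) - 1)))" using P by simp
  also have "cmod (of_int (lead_coeff f) ^ (2 * k) * (\<Prod>h\<in>H. h \<alpha> * h (\<tau> \<alpha>) - 1))
      = a ^ (2 * k) * (\<Prod>h\<in>H. cmod (h \<alpha> * h (\<tau> \<alpha>) - 1))"
    using f(2) by (simp add: norm_mult norm_power prod_norm[symmetric] a_def)
  also have "ln \<dots> = 2 * k * ln a + (\<Sum>h\<in>H. u h)"
  proof -
    have "(\<Prod>h\<in>H. cmod (h \<alpha> * h (\<tau> \<alpha>) - 1)) > 0" using Hne by (intro prod_pos) auto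
    moreover have "ln (\<Prod>h\<in>H. cmod (h \<alpha> * h (\<tau> \<alpha>) - 1)) = (\<Sum>h\<in>H. u h)"
      unfolding u_def by (rule ln_prod) (use Hne finH in auto)
    ultimately show ?thesis using a by (simp add: ln_mult_pos ln_realpow)
  qed
  finally have 1: "0 \<le> 2 * k * ln a + (\<Sum>h\<in>H. u h)" .
  have gH: "good \<subseteq> H" by (auto simp: good_def)
  have "(\<Sum>h\<in>H. u h) \<le> (\<Sum>h\<in>H. ln 2 + L (h \<alpha>) + L (h (\<tau> \<alpha>))
      + (if h \<in> good then 2 * A * \<bar>ln (cmod (h \<alpha>))\<bar> - 2 * m * ln 2 else 0))"
    by (rule sum_mono) (use u_le u_good in auto)
  also have "\<dots> = card H * ln 2 + (\<Sum>h\<in>H. L (h \<alpha>)) + (\<Sum>h\<in>H. L (h (\<tau> \<alpha>)))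
      + (\<Sum>h\<in>good. 2 * A * \<bar>ln (cmod (h \<alpha>))\<bar> - 2 * m * ln 2)"
    using finH gH by (simp add: sum.distrib sum.inter_restrict[symmetric] Int_absorb1)
  also have "(\<Sum>h\<in>H. L (h \<alpha>)) = k * (\<Sum>z\<in>Z. L z)" by (rule sumH[OF \<alpha>Z])
  also have "(\<Sum>h\<in>H. L (h (\<tau> \<alpha>))) = k * (\<Sum>z\<in>Z. L z)" by (rule sumH[OF \<tau>Z])
  also have "(\<Sum>h\<in>good. 2 * A * \<bar>ln (cmod (h \<alpha>))\<bar> - 2 * m * ln 2)
      = 2 * A * (\<Sum>h\<in>good. \<bar>ln (cmod (h \<alpha>))\<bar>) - real (m * card good) * (2 * ln 2)"
    by (simp add: sum_subtractf sum_distrib_left)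
  finally have 2: "(\<Sum>h\<in>H. u h) \<le> card H * ln 2 + k * (\<Sum>z\<in>Z. L z) + k * (\<Sum>z\<in>Z. L z)
      + (2 * A * (\<Sum>h\<in>good. \<bar>ln (cmod (h \<alpha>))\<bar>) - real (m * card good) * (2 * ln 2))" .
  have "(\<Sum>h\<in>good. \<bar>ln (cmod (h \<alpha>))\<bar>) \<le> (\<Sum>h\<in>H. \<bar>ln (cmod (h \<alpha>))\<bar>)"
    by (rule sum_mono2[OF finH gH]) simp
  also have "(\<Sum>h\<in>H. \<bar>ln (cmod (h \<alpha>))\<bar>) = k * (\<Sum>z\<in>Z. \<bar>ln (cmod z)\<bar>)"
    by (rule sumH[OF \<alpha>Z])
  also have "\<dots> \<le> k * (2 * (d * hh))"
    using sum_abs_ln_roots_le[OF \<alpha>] by (intro mult_left_mono) (simp_all add: Z_def f_def d_def hh_def)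
  finally have 3: "2 * A * (\<Sum>h\<in>good. \<bar>ln (cmod (h \<alpha>))\<bar>) \<le> 2 * A * (k * (2 * (d * hh)))"
    by (rule mult_left_mono) (simp add: A_def)
  have 4: "real (card H) * (2 * ln 2) \<le> real (m * card good) * (2 * ln 2)"
    by (rule mult_right_mono) (use good in \<open>simp_all only: of_nat_le_iff, simp\<close>)
  have dh: "d * hh = ln a + (\<Sum>z\<in>Z. L z)"
    using weil_height_eq[OF alg] by (simp add: f_def Z_def d_def hh_def a_def L_def)
  \<comment> \<open>Per element of \<open>H\<close>, the gain \<open>2 * ln 2\<close> minus the loss
    \<open>ln 2\<close> leaves \<open>ln 2\<close>. On the right, leading coefficients and maxima
    contribute twice the height, and the terms \<open>\<bar>ln (cmod z)\<bar>\<close> contribute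
    \<open>4 * A\<close> times the height.\<close>
  have "card H * ln 2 \<le> 2 * k * (ln a + (\<Sum>z\<in>Z. L z)) + 2 * A * (k * (2 * (d * hh)))"
    using 1 2 3 4 unfolding distrib_left by linarith
  also have "\<dots> = real (k * d) * ((2 + 4 * A) * hh)"
    unfolding dh[symmetric] by (simp add: algebra_simps)
  finally have "card H * ln 2 \<le> card H * ((2 + 4 * A) * hh)" by (simp only: cardH)
  then have le: "ln 2 \<le> (2 + 4 * A) * hh" using Hpos by simp
  have "0 < 2 + 4 * A" by (simp add: A_def add_pos_pos)
  then have "ln 2 / (2 + 4 * A) \<le> hh" using le by (simp only: pos_divide_le_eq mult.commute)
  then show ?thesis by (simp only: A_def m_def hh_def)
qed


section \<open>Computability of the bound\<close>

lemma total_recursive_comp1: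
  assumes "total_recursive 1 g" "total_recursive n f"
  shows "total_recursive n (\<lambda>xs. g [f xs])"
  using total_recursive.comp[of "[f]" g n] assms by simp

lemma total_recursive_comp2:
  assumes "total_recursive 2 g" "total_recursive n f\<^sub>1" "total_recursive n f\<^sub>2"
  shows "total_recursive n (\<lambda>xs. g [f\<^sub>1 xs, f\<^sub>2 xs])"
  using total_recursive.comp[of "[f\<^sub>1, f\<^sub>2]" g n] assms by (simp add: numeral_2_eq_2)

lemma total_recursive_Suc: "total_recursive n f \<Longrightarrow> total_recursive n (\<lambda>xs. Suc (f xs))"
  using total_recursive_comp1[OF total_recursive.succ, of n f] by simp

lemma total_recursive_const: "total_recursive n (\<lambda>_. c)"
  by (induction c) (auto intro: total_recursive.zero total_recursive_Suc)

lemma total_recursive_rec1: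
  assumes "total_recursive 2 h"
  shows "total_recursive 1 (\<lambda>xs. rec_nat c (\<lambda>k r. h [k, r]) (hd xs))"
proof -
  \<comment> \<open>Repackaged to read two entries only: \<open>tl xs\<close> is not known to be
    empty, since the functions act on lists of every length.\<close>
  have h: "total_recursive (Suc (Suc 0)) (\<lambda>ys. h [ys ! 0, ys ! 1])"
    using total_recursive_comp2[OF assms total_recursive.proj[of 0 2] total_recursive.proj[of 1 2]]
    by (simp add: numeral_2_eq_2)
  show ?thesis using total_recursive.prec[OF total_recursive_const[of 0 c] h] by simp
qed

lemma total_recursive_add: "\<exists>N. total_recursive 2 N \<and> (\<forall>a b. N [a, b] = a + b)"
proof -
  have h: "total_recursive (Suc (Suc 1)) (\<lambda>ys. Suc (ys ! 1))"
    by (intro total_recursive_Suc total_recursive.proj) simp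
  have e: "rec_nat b (\<lambda>k r. Suc r) a = a + b" for a b :: nat by (induction a) auto
  show ?thesis
    using total_recursive.prec[OF total_recursive.proj[of 0 1] h] e
    by (intro exI conjI) (auto simp: numeral_2_eq_2)
qed

lemma total_recursive_mult: "\<exists>N. total_recursive 2 N \<and> (\<forall>a b. N [a, b] = a * b)"
proof -
  obtain add where add: "total_recursive 2 add" "\<And>a b. add [a, b] = a + b"
    using total_recursive_add by blast
  have h: "total_recursive (Suc (Suc 1)) (\<lambda>ys. add [ys ! 2, ys ! 1])"
    using total_recursive_comp2[OF add(1) total_recursive.proj[of 2 3] total_recursive.proj[of 1 3]]
    by (simp add: numeral_3_eq_3)
  have e: "rec_nat 0 (\<lambda>k r. b + r) a = a * b" for a b :: nat by (induction a) auto
  show ?thesis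
    using total_recursive.prec[OF total_recursive.zero[of 1] h] e
    by (intro exI conjI) (auto simp: numeral_2_eq_2 add)
qed

lemma total_recursive_fact: "\<exists>N. total_recursive 1 N \<and> (\<forall>a. N [a] = fact a)"
proof -
  obtain mul where mul: "total_recursive 2 mul" "\<And>a b. mul [a, b] = a * b"
    using total_recursive_mult by blast
  have h: "total_recursive 2 (\<lambda>ys. mul [Suc (ys ! 0), ys ! 1])"
    by (rule total_recursive_comp2[OF mul(1) total_recursive_Suc total_recursive.proj])
      (simp_all add: total_recursive.proj)
  have e: "rec_nat 1 (\<lambda>k r. Suc k * r) a = fact a" for a :: nat by (induction a) auto
  show ?thesis
    using total_recursive_rec1[OF h, of 1] e by (intro exI conjI) (auto simp: mul)
qed

lemma total_recursive_exp2: "\<exists>N. total_recursive 1 N \<and> (\<forall>a. N [a] = 2 ^ a)"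
proof -
  obtain add where add: "total_recursive 2 add" "\<And>a b. add [a, b] = a + b"
    using total_recursive_add by blast
  have h: "total_recursive 2 (\<lambda>ys. add [ys ! 1, ys ! 1])"
    by (rule total_recursive_comp2[OF add(1) total_recursive.proj total_recursive.proj]) simp_all
  have e: "rec_nat 1 (\<lambda>k r. r + r) a = (2::nat) ^ a" for a :: nat by (induction a) auto
  show ?thesis
    using total_recursive_rec1[OF h, of 1] e by (intro exI conjI) (auto simp: add)
qed

text \<open>With \<open>n = fact (a + b)\<close> the value is \<open>16 * 4 ^ n\<close>, an integer
  above \<open>(2 + 4 * 4 ^ n) / ln 2\<close>, the reciprocal of the height bound.\<close>

lemma total_recursive_bound:
  "\<exists>N. total_recursive 2 N \<and> (\<forall>a b. N [a, b] = 2 ^ (2 * fact (a + b) + 4))"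
proof -
  obtain add where add: "total_recursive 2 add" "\<And>a b. add [a, b] = a + b"
    using total_recursive_add by blast
  obtain mul where mul: "total_recursive 2 mul" "\<And>a b. mul [a, b] = a * b"
    using total_recursive_mult by blast
  obtain fac where fac: "total_recursive 1 fac" "\<And>a. fac [a] = fact a"
    using total_recursive_fact by blast
  obtain ex where ex: "total_recursive 1 ex" "\<And>a. ex [a] = 2 ^ a"
    using total_recursive_exp2 by blast
  have "total_recursive 2 (\<lambda>xs. add [xs ! 0, xs ! 1])"
    by (rule total_recursive_comp2[OF add(1) total_recursive.proj total_recursive.proj]) simp_all
  from total_recursive_comp2[OF mul(1) total_recursive_const[of 2 2] total_recursive_comp1[OF fac(1) this]]
  have "total_recursive 2 (\<lambda>xs. mul [2, fac [add [xs ! 0, xs ! 1]]])" .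
  from total_recursive_comp1[OF ex(1) total_recursive_comp2[OF add(1) this total_recursive_const[of 2 4]]]
  have "total_recursive 2 (\<lambda>xs. ex [add [mul [2, fac [add [xs ! 0, xs ! 1]]], 4]])" .
  then show ?thesis
    by (intro exI[of _ "\<lambda>xs. ex [add [mul [2, fac [add [xs ! 0, xs ! 1]]], 4]]"] conjI)
      (simp_all add: add mul fac ex)
qed

section \<open>Codes as upper bounds for degrees\<close>

lemma le_triangle: "n \<le> triangle n"
  by (induction n) auto

lemma sum_list_le_list_encode: "sum_list xs \<le> list_encode xs"
proof (induction xs)
  case (Cons x xs)
  have "x + list_encode xs \<le> prod_encode (x, list_encode xs)"
    using le_triangle[of "x + list_encode xs"] by (simp add: prod_encode_def)
  then show ?case using Cons by simp
qed simp

lemma length_le_list_encode: "length xs \<le> list_encode xs"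
proof (induction xs)
  case (Cons x xs)
  then show ?case using le_prod_encode_2[of "list_encode xs" x] by simp
qed simp

text \<open>Lets the codes themselves stand in for the degrees, so that the recursive bound is
  computed without decoding the polynomials.\<close>

lemma sum_degree_le_polys_code: "(\<Sum>p\<leftarrow>ps. degree p) \<le> polys_code ps"
proof -
  have "degree p \<le> list_encode (map int_encode (coeffs p))" for p :: "int poly"
  proof (cases "p = 0")
    case False
    then have "degree p \<le> length (map int_encode (coeffs p))" by (simp add: length_coeffs_degree)
    then show ?thesis using length_le_list_encode le_trans by blast
  qed simp
  then have "(\<Sum>p\<leftarrow>ps. degree p) \<le> (\<Sum>p\<leftarrow>ps. list_encode (map int_encode (coeffs p)))"
    by (rule sum_list_mono)
  also have "\<dots> \<le> polys_code ps" unfolding polys_code_def by (rule sum_list_le_list_encode)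
  finally show ?thesis .
qed


section \<open>Finite extensions of the totally real field\<close>

lemma field_CC: "field CC"
  by (rule field_from_type_algebra)

interpretation CC: domain CC
  by (rule field.axioms(1)[OF field_CC])

lemma CC_a_inv: "\<ominus>\<^bsub>CC\<^esub> x = - x"
  using CC.minus_equality[of "- x" x] by simp

lemma CC_m_inv: "x \<noteq> 0 \<Longrightarrow> inv\<^bsub>CC\<^esub> x = inverse x"
  using CC.comm_inv_char[of x "inverse x"] by simp

lemma CC_pow: "x [^]\<^bsub>CC\<^esub> (n::nat) = x ^ n"
  by (induction n) (simp_all add: mult.commute)

lemma subfield_CC_closed:
  assumes "subfield K CC"
  shows "1 \<in> K" "0 \<in> K" "x \<in> K \<Longrightarrow> y \<in> K \<Longrightarrow> x + y \<in> K" "x \<in> K \<Longrightarrow> y \<in> K \<Longrightarrow> x * y \<in> K"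
    "x \<in> K \<Longrightarrow> - x \<in> K" "x \<in> K \<Longrightarrow> x \<noteq> 0 \<Longrightarrow> inverse x \<in> K"
  using subringE[OF subfieldE(1)[OF assms]] CC.subfield_m_inv(1)[OF assms, of x]
  by (auto simp: CC_a_inv CC_m_inv)

lemma subfield_CC_I:
  assumes "1 \<in> K" "\<And>x y. x \<in> K \<Longrightarrow> y \<in> K \<Longrightarrow> x + y \<in> K" "\<And>x y. x \<in> K \<Longrightarrow> y \<in> K \<Longrightarrow> x * y \<in> K"
    "\<And>x. x \<in> K \<Longrightarrow> - x \<in> K" "\<And>x. x \<in> K \<Longrightarrow> x \<noteq> 0 \<Longrightarrow> inverse x \<in> K"
  shows "subfield K CC"
  by (rule field.subfieldI'[OF field_CC CC.subringI]) (use assms in \<open>auto simp: CC_a_inv CC_m_inv\<close>)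

text \<open>Two automorphisms agree on a field. This is applied to \<sigma> and the identity on
  \<open>K\<close>, and to \<open>cnj \<circ> \<sigma>\<close> and
  \<open>\<sigma> \<circ> \<tau>\<close> on \<open>F\<close>.\<close>

lemma generate_field_agree:
  assumes "\<sigma> \<in> GQ" "\<tau> \<in> GQ" "H \<subseteq> Qbar" "\<And>x. x \<in> H \<Longrightarrow> \<sigma> x = \<tau> x"
    and "x \<in> generate_field CC H"
  shows "x \<in> Qbar \<and> \<sigma> x = \<tau> x"
  using assms(5)
proof induction
  case (m_inv h)
  then show ?case using GQ_inverse[OF assms(1)] GQ_inverse[OF assms(2)] by (simp add: CC_m_inv Qbar_closed)
qed (use assms(1-4) in \<open>auto simp: CC_a_inv Qbar_closed GQ_one GQ_uminus GQ_hom\<close>)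

text \<open>All roots are taken, not just the chosen generators, to make the set Galois stable. The
  condition on \<open>p\<close> inside the set keeps it finite when the zero polynomial is
  listed.\<close>

definition root_set :: "int poly list \<Rightarrow> complex set" where
  "root_set ps = (\<Union>p\<in>set ps. {z. p \<noteq> 0 \<and> poly (cpoly p) z = 0})"

lemma root_set_Qbar: "root_set ps \<subseteq> Qbar"
  unfolding root_set_def Qbar_def algebraic_cpoly by blast

lemma root_set_GQ: "\<sigma> \<in> GQ \<Longrightarrow> x \<in> root_set ps \<Longrightarrow> \<sigma> x \<in> root_set ps"
  using root_set_Qbar GQ_root unfolding root_set_def by fastforce

lemma card_root_set: "finite (root_set ps) \<and> card (root_set ps) \<le> (\<Sum>p\<leftarrow>ps. degree p)"
proof (induction ps)
  case (Cons p ps)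
  define Z where "Z = {z. p \<noteq> 0 \<and> poly (cpoly p) z = 0}"
  have Z: "finite Z \<and> card Z \<le> degree p"
  proof (cases "p = 0")
    case False
    then show ?thesis using poly_roots_finite[of "cpoly p"] card_poly_roots_bound[of "cpoly p"]
      by (simp add: Z_def)
  qed (simp add: Z_def)
  have "root_set (p # ps) = Z \<union> root_set ps" by (simp add: root_set_def Z_def)
  then show ?case using Cons Z card_Un_le[of Z "root_set ps"] by simp
qed (simp add: root_set_def)

lemma list_all2_root_set:
  "list_all2 (\<lambda>p \<gamma>. p \<noteq> 0 \<and> poly (cpoly p) \<gamma> = 0) ps \<gamma>s \<Longrightarrow> set \<gamma>s \<subseteq> root_set ps"
  by (induction rule: list_all2_induct) (auto simp: root_set_def)

lemma weil_height_bound_presents: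
  assumes pres: "presents ps qs K F" and \<alpha>: "\<alpha> \<in> F" "\<alpha> \<noteq> 0"
    and \<sigma>0: "\<sigma>\<^sub>0 \<in> Gal_Qbar K" "cmod (\<sigma>\<^sub>0 \<alpha>) \<noteq> 1"
  shows "weil_height \<alpha> \<ge> 1 / real (Suc (2 ^ (2 * fact (polys_code ps + polys_code qs) + 4)))"
proof -
  obtain \<gamma>s \<beta>s where all2: "list_all2 (\<lambda>p \<gamma>. p \<noteq> 0 \<and> poly (cpoly p) \<gamma> = 0) ps \<gamma>s"
      "list_all2 (\<lambda>q \<beta>. q \<noteq> 0 \<and> poly (cpoly q) \<beta> = 0) qs \<beta>s"
    and K: "K = generate_field CC (set \<gamma>s)"
    and F: "F = generate_field CC (tot_real K \<union> set \<beta>s)"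
    using pres unfolding presents_def by blast
  note \<gamma>s = list_all2_root_set[OF all2(1)] and \<beta>s = list_all2_root_set[OF all2(2)]
  define S where "S = root_set (ps @ qs)"
  have SU: "S = root_set ps \<union> root_set qs" by (auto simp: S_def root_set_def)
  have SQ: "S \<subseteq> Qbar" unfolding S_def by (rule root_set_Qbar)
  have \<sigma>0G: "\<sigma>\<^sub>0 \<in> GQ" using \<sigma>0(1) Gal_Qbar_mono by blast
  obtain \<rho> where \<rho>: "\<rho> \<in> GQ" "\<And>x. x \<in> Qbar \<Longrightarrow> \<sigma>\<^sub>0 (\<rho> x) = x" "\<And>x. x \<in> Qbar \<Longrightarrow> \<rho> (\<sigma>\<^sub>0 x) = x"
    using GQ_inv[OF \<sigma>0G] by metis
  define \<tau> where "\<tau> = \<rho> \<circ> (cnj \<circ> \<sigma>\<^sub>0)"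
  have \<tau>: "\<tau> \<in> GQ" unfolding \<tau>_def by (intro GQ_comp \<rho> GQ_cnj \<sigma>0G)
  have main: "x \<in> Qbar \<and> (cnj \<circ> \<sigma>) x = (\<sigma> \<circ> \<tau>) x"
    if \<sigma>: "\<sigma> \<in> GQ" and S: "\<And>s. s \<in> S \<Longrightarrow> \<sigma> s = \<sigma>\<^sub>0 s" and x: "x \<in> F" for \<sigma> x
  proof (rule generate_field_agree)
    show "cnj \<circ> \<sigma> \<in> GQ" "\<sigma> \<circ> \<tau> \<in> GQ" by (intro GQ_comp GQ_cnj \<sigma> \<tau>)+
    show "x \<in> generate_field CC (tot_real K \<union> set \<beta>s)" using x F by simp
    show "tot_real K \<union> set \<beta>s \<subseteq> Qbar" using \<beta>s SQ SU by (auto simp: tot_real_def)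
    \<comment> \<open>The generators of \<open>K\<close> lie in \<open>S\<close> and are fixed by
      \<open>\<sigma>\<^sub>0\<close>, hence by \<sigma>. So \<sigma> belongs to the Galois group
      over \<open>K\<close> and takes real values on \<open>tot_real K\<close>.\<close>
    have "\<sigma> y = id y" if "y \<in> K" for y
    proof -
      have "y \<in> Qbar \<and> \<sigma> y = id y"
      proof (rule generate_field_agree[OF \<sigma>])
        show "id \<in> GQ" by (simp add: Gal_Qbar_iff)
        show "set \<gamma>s \<subseteq> Qbar" using \<gamma>s SQ SU by blast
        show "y \<in> generate_field CC (set \<gamma>s)" using that K by simp
        fix z assume z: "z \<in> set \<gamma>s"
        then have "z \<in> K" unfolding K by (rule generate_field.incl)
        then have "\<sigma>\<^sub>0 z = z" using \<sigma>0(1) by (simp add: Gal_Qbar_iff)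
        then show "\<sigma> z = id z" using S z \<gamma>s SU by auto
      qed
      then show ?thesis ..
    qed
    then have \<sigma>K: "\<sigma> \<in> Gal_Qbar K" using \<sigma> by (simp add: Gal_Qbar_iff)
    fix z assume "z \<in> tot_real K \<union> set \<beta>s"
    then show "(cnj \<circ> \<sigma>) z = (\<sigma> \<circ> \<tau>) z"
    proof
      \<comment> \<open>Here \<open>\<sigma>\<^sub>0 z\<close> is real, so \<tau> fixes
        \<open>z\<close>, and conjugation does nothing to the real number \<sigma>(z).\<close>
      assume z: "z \<in> tot_real K"
      then have "cnj (\<sigma> z) = \<sigma> z" "cnj (\<sigma>\<^sub>0 z) = \<sigma>\<^sub>0 z" "z \<in> Qbar"
        using \<sigma>K \<sigma>0(1) by (auto simp: tot_real_def Reals_cnj_iff)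
      then show ?thesis by (simp add: \<tau>_def \<rho>(3))
    next
      assume "z \<in> set \<beta>s"
      then have z: "z \<in> S" using \<beta>s SU by blast
      \<comment> \<open>Stability of \<open>S\<close> allows replacing \<sigma> by
        \<open>\<sigma>\<^sub>0\<close> at \<tau>(z) too, where the identity holds by the choice of
        \<tau>.\<close>
      then have "\<tau> z \<in> S" unfolding S_def by (rule root_set_GQ[OF \<tau>])
      then have "\<sigma> (\<tau> z) = \<sigma>\<^sub>0 (\<tau> z)" using S by blast
      also have "\<dots> = cnj (\<sigma>\<^sub>0 z)"
        using \<rho>(2)[of "cnj (\<sigma>\<^sub>0 z)"] GQ_Qbar[OF \<sigma>0G, of z] z SQ by (auto simp: \<tau>_def Qbar_closed)
      finally show ?thesis using S z by simp
    qed
  qed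
  have \<alpha>Q: "\<alpha> \<in> Qbar" using main[OF \<sigma>0G refl \<alpha>(1)] by blast
  define m n :: nat where "m = fact (card S)" and "n = fact (polys_code ps + polys_code qs)"
  have "card S \<le> polys_code ps + polys_code qs"
    using card_root_set[of "ps @ qs"] sum_degree_le_polys_code[of ps] sum_degree_le_polys_code[of qs]
    by (simp add: S_def)
  then have mn: "m \<le> n" unfolding m_def n_def by (rule fact_mono)
  have "weil_height \<alpha> \<ge> ln 2 / (2 + 4 * 4 ^ m)"
    unfolding m_def
  proof (rule weil_height_lower_bound[OF \<alpha>Q \<alpha>(2) _ SQ _ \<sigma>0G \<sigma>0(2) \<tau>])
    show "finite S" using card_root_set S_def by blast
    show "\<sigma> x \<in> S" if "\<sigma> \<in> GQ" "x \<in> S" for \<sigma> x using that root_set_GQ by (simp add: S_def)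
    show "cnj (\<sigma> \<alpha>) = \<sigma> (\<tau> \<alpha>)" if "\<sigma> \<in> GQ" "\<And>s. s \<in> S \<Longrightarrow> \<sigma> s = \<sigma>\<^sub>0 s" for \<sigma>
      using main[OF that \<alpha>(1)] by simp
  qed
  moreover have "1 / real (Suc (2 ^ (2 * n + 4))) \<le> ln 2 / (2 + 4 * 4 ^ m)"
  proof -
    have "ln (1 / 2) \<le> 1 / 2 - (1::real)" by (rule ln_le_minus_one) simp
    then have l: "1 / 2 \<le> ln (2::real)" by (simp add: ln_div)
    have e: "real (Suc (2 ^ (2 * n + 4))) = 16 * 4 ^ n + 1"
      by (simp add: power_add power_mult)
    have "(4::real) ^ m \<le> 4 ^ n" using mn by (intro power_increasing) auto
    moreover have "(1::real) \<le> 4 ^ n" by simp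
    moreover have "2 * (2 + 4 * x) \<le> 16 * y + 1" if "x \<le> y" "1 \<le> y" for x y :: real
      using that by (simp add: algebra_simps)
    ultimately have "2 * (2 + 4 * 4 ^ m) \<le> real (Suc (2 ^ (2 * n + 4)))" unfolding e by blast
    then have "1 / real (Suc (2 ^ (2 * n + 4))) \<le> 1 / (2 * (2 + 4 * 4 ^ m))"
      by (intro divide_left_mono) (auto intro!: mult_pos_pos add_pos_pos)
    also have "\<dots> = (1 / 2) / (2 + 4 * 4 ^ m)" by simp
    also have "\<dots> \<le> ln 2 / (2 + 4 * 4 ^ m)" using l by (intro divide_right_mono) (auto intro: add_nonneg_nonneg)
    finally show ?thesis .
  qed
  ultimately show ?thesis by (simp add: n_def)
qed

section \<open>Presentations of number fields and finite extensions\<close>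

lemma CC_eval_poly:
  assumes "set xs \<subseteq> E" "0 \<in> E"
  shows "\<exists>q. (\<forall>i. coeff q i \<in> E) \<and> (\<forall>i\<ge>length xs. coeff q i = 0) \<and>
    (xs \<noteq> [] \<longrightarrow> coeff q (length xs - 1) = hd xs) \<and> poly q x = CC.eval xs x"
  using assms(1)
proof (induction xs)
  case Nil
  show ?case by (rule exI[of _ 0]) (simp add: assms(2))
next
  case (Cons a xs)
  then obtain q where q: "\<forall>i. coeff q i \<in> E" "\<forall>i\<ge>length xs. coeff q i = 0" "poly q x = CC.eval xs x"
    by auto
  show ?case
    \<comment> \<open>Coefficient lists start with the leading coefficient, so the head
      \<open>a\<close> belongs to degree \<open>length xs\<close>.\<close>
    by (rule exI[of _ "monom a (length xs) + q"])
      (use Cons.prems q in \<open>auto simp: poly_monom CC_pow\<close>)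
qed

text \<open>Finite dimension gives each element an equation over \<open>E\<close>, whose
  coefficients are algebraic. The \<open>hd xs\<close> clause of \<open>CC_eval_poly\<close> shows
  that the equation is nontrivial.\<close>

lemma finite_dimension_subset_Qbar:
  assumes E: "subfield E CC" "E \<subseteq> Qbar" and F: "subfield F CC" and fin: "CC.finite_dimension E F"
  shows "F \<subseteq> Qbar"
proof
  fix x assume "x \<in> F"
  then have "(CC.algebraic over E) x"
    using CC.finite_dimension_imp_algebraic[OF E(1) subfieldE(1)[OF F] fin] by blast
  then obtain xs where xs: "xs \<in> carrier (E [X]\<^bsub>CC\<^esub>)" "xs \<noteq> []" "CC.eval xs x = 0"
    using CC.algebraicE[OF subfieldE(1)[OF E(1)], of x] by auto
  then have set: "set xs \<subseteq> E" "hd xs \<noteq> 0"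
    unfolding univ_poly_carrier[symmetric] polynomial_def by auto
  obtain q where q: "\<forall>i. coeff q i \<in> E" "coeff q (length xs - 1) = hd xs" "poly q x = 0"
    using CC_eval_poly[OF set(1) subfield_CC_closed(2)[OF E(1)], of x] xs by auto
  have "q \<noteq> 0" using q(2) set(2) by auto
  then have "algebraic x"
    by (rule algebraic_root_algebraic_coeffs) (use q E(2) in \<open>auto simp: Qbar_def\<close>)
  then show "x \<in> Qbar" by (simp add: Qbar_def)
qed

lemma finite_dimension_generate_field:
  assumes E: "subfield E CC" and F: "subfield F CC" and "E \<subseteq> F" and fin: "CC.finite_dimension E F"
  obtains Us where "set Us \<subseteq> F" "F = generate_field CC (E \<union> set Us)"
proof -
  obtain n where "CC.dimension n E F" using fin by auto
  then obtain Us where Us: "CC.Span E Us = F" using CC.exists_base[OF E] by blast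
  then have UF: "set Us \<subseteq> F" using CC.Span_base_incl[OF E, of Us] by simp
  have "set Vs \<subseteq> set Us \<Longrightarrow> CC.Span E Vs \<subseteq> generate_field CC (E \<union> set Us)" for Vs
  proof (induction Vs)
    case Nil
    then show ?case using field.zero_in_generate[OF field_CC] by simp
  next
    case (Cons v Vs)
    show ?case
    proof
      fix u assume "u \<in> CC.Span E (v # Vs)"
      then obtain a w where "a \<in> E" "w \<in> CC.Span E Vs" "u = a * v + w"
        using CC.line_extension_mem_iff by auto
      moreover have "v \<in> set Us" using Cons.prems by simp
      ultimately show "u \<in> generate_field CC (E \<union> set Us)"
        using Cons generate_field.eng_add[of _ CC] generate_field.eng_mult[of _ CC] generate_field.incl[of _ "E \<union> set Us" CC]
        by auto
    qed
  qed
  then have "F \<subseteq> generate_field CC (E \<union> set Us)" using Us by blast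
  moreover have "generate_field CC (E \<union> set Us) \<subseteq> F"
    by (rule field.generate_field_min_subfield1[OF field_CC]) (use F UF \<open>E \<subseteq> F\<close> in auto)
  ultimately show thesis using that UF by blast
qed

lemma Rats_subset_subfield:
  assumes "subfield K CC"
  shows "\<rat> \<subseteq> K"
proof
  fix x :: complex assume "x \<in> \<rat>"
  then obtain a b :: int where x: "x = of_int a / of_int b" "b > 0" by (auto elim: Rats_cases')
  note cl = subfield_CC_closed[OF assms]
  have "of_int n \<in> K" for n
  proof (induction n rule: int_induct[where k = 0])
    case (step2 i)
    then show ?case using cl(3)[OF _ cl(5)[OF cl(1)]] by simp
  qed (auto intro: cl)
  then show "x \<in> K" using x cl(4,6) by (simp add: divide_inverse)
qed

lemma subfield_Rats: "subfield \<rat> CC"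
  by (rule subfield_CC_I) auto

lemma Qbar_presentation:
  "set xs \<subseteq> Qbar \<Longrightarrow> \<exists>ps. list_all2 (\<lambda>p x. p \<noteq> 0 \<and> poly (cpoly p) x = 0) ps xs"
proof (induction xs)
  case (Cons x xs)
  then obtain ps where "list_all2 (\<lambda>p x. p \<noteq> 0 \<and> poly (cpoly p) x = 0) ps xs" by auto
  moreover obtain p where "p \<noteq> 0" "poly (cpoly p) x = 0"
    using Cons.prems unfolding Qbar_def algebraic_cpoly by auto
  ultimately show ?case by (intro exI[of _ "p # ps"]) simp
qed simp

lemma presents_exists:
  assumes "number_field K" "finite_field_ext (tot_real K) F"
  shows "\<exists>ps qs. presents ps qs K F"
proof -
  have K: "subfield K CC" "CC.finite_dimension \<rat> K" using assms(1) by (auto simp: number_field_def)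
  have F: "subfield (tot_real K) CC" "subfield F CC" "tot_real K \<subseteq> F" "CC.finite_dimension (tot_real K) F"
    using assms(2) by (auto simp: finite_field_ext_def)
  have "\<rat> \<subseteq> Qbar" by (auto simp: Qbar_def intro: rat_imp_algebraic)
  then have KQ: "K \<subseteq> Qbar" using finite_dimension_subset_Qbar[OF subfield_Rats _ K] by blast
  have FQ: "F \<subseteq> Qbar"
    by (rule finite_dimension_subset_Qbar[OF F(1) _ F(2,4)]) (auto simp: tot_real_def)
  obtain \<gamma>s where \<gamma>s: "set \<gamma>s \<subseteq> K" "K = generate_field CC (\<rat> \<union> set \<gamma>s)"
    using finite_dimension_generate_field[OF subfield_Rats K(1) Rats_subset_subfield[OF K(1)] K(2)] .
  obtain \<beta>s where \<beta>s: "set \<beta>s \<subseteq> F" "F = generate_field CC (tot_real K \<union> set \<beta>s)"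
    using finite_dimension_generate_field[OF F] .
  have sub: "subfield (generate_field CC (set \<gamma>s)) CC" by (rule field.generate_field_is_subfield[OF field_CC]) simp
  have "K = generate_field CC (set \<gamma>s)"
  proof
    show "K \<subseteq> generate_field CC (set \<gamma>s)"
      unfolding \<gamma>s(2)
      by (rule field.generate_field_min_subfield1[OF field_CC _ sub])
        (use Rats_subset_subfield[OF sub] in \<open>auto intro: generate_field.incl\<close>)
    show "generate_field CC (set \<gamma>s) \<subseteq> K"
      by (rule field.generate_field_min_subfield1[OF field_CC _ K(1) \<gamma>s(1)]) simp
  qed
  moreover obtain ps qs where "list_all2 (\<lambda>p x. p \<noteq> 0 \<and> poly (cpoly p) x = 0) ps \<gamma>s"
    "list_all2 (\<lambda>p x. p \<noteq> 0 \<and> poly (cpoly p) x = 0) qs \<beta>s"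
    using Qbar_presentation[of \<gamma>s] Qbar_presentation[of \<beta>s] \<gamma>s(1) \<beta>s(1) KQ FQ by blast
  ultimately show ?thesis unfolding presents_def using \<beta>s(2) by blast
qed

theorem theorem1p1:
  shows "\<exists>c :: complex set \<Rightarrow> complex set \<Rightarrow> real.
    effective_constant c \<and>
    (\<forall>K F. number_field K \<and> finite_field_ext (tot_real K) F \<longrightarrow>
       c K F > 0 \<and>
       (\<forall>\<alpha>\<in>F - {0}. (\<exists>\<sigma>\<in>Gal_Qbar K. cmod (\<sigma> \<alpha>) \<noteq> 1) \<longrightarrow> weil_height \<alpha> \<ge> c K F))"
proof -
  obtain N where N: "total_recursive 2 N" "\<And>a b. N [a, b] = 2 ^ (2 * fact (a + b) + 4)"
    using total_recursive_bound by blast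
  define B where "B ps qs = 1 / real (Suc (N [polys_code ps, polys_code qs]))" for ps qs
  \<comment> \<open>The constant may depend on the fields only, hence the supremum over all presentations.\<close>
  define c where "c K F = Sup {B ps qs |ps qs. presents ps qs K F}" for K F
  have B: "0 < B ps qs" "B ps qs \<le> 1" for ps qs by (simp_all add: B_def)
  have c_ge: "B ps qs \<le> c K F" if "presents ps qs K F" for ps qs K F
    unfolding c_def by (rule cSup_upper) (use that B(2) in \<open>auto intro!: bdd_aboveI[of _ 1]\<close>)
  have "effective_constant c"
    unfolding effective_constant_def using N(1) c_ge by (auto simp: B_def)
  moreover have "c K F > 0 \<and>
      (\<forall>\<alpha>\<in>F - {0}. (\<exists>\<sigma>\<in>Gal_Qbar K. cmod (\<sigma> \<alpha>) \<noteq> 1) \<longrightarrow> weil_height \<alpha> \<ge> c K F)"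
    if KF: "number_field K" "finite_field_ext (tot_real K) F" for K F
  proof (intro conjI ballI impI)
    obtain ps qs where pres: "presents ps qs K F" using presents_exists[OF KF] by blast
    show "c K F > 0" using c_ge[OF pres] B(1)[of ps qs] by linarith
    fix \<alpha> assume \<alpha>: "\<alpha> \<in> F - {0}" and "\<exists>\<sigma>\<in>Gal_Qbar K. cmod (\<sigma> \<alpha>) \<noteq> 1"
    then obtain \<sigma> where \<sigma>: "\<sigma> \<in> Gal_Qbar K" "cmod (\<sigma> \<alpha>) \<noteq> 1" by blast
    show "c K F \<le> weil_height \<alpha>"
      unfolding c_def
    \<comment> \<open>Each presentation alone yields a lower bound for the height, hence so does the
      supremum.\<close>
    proof (rule cSup_least)
      show "{B ps qs |ps qs. presents ps qs K F} \<noteq> {}" using pres by blast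
      fix b assume "b \<in> {B ps qs |ps qs. presents ps qs K F}"
      then obtain ps qs where b: "b = B ps qs" "presents ps qs K F" by blast
      show "b \<le> weil_height \<alpha>"
        using weil_height_bound_presents[OF b(2) _ _ \<sigma>] \<alpha> unfolding b(1) B_def N(2) by simp
    qed
  qed
  ultimately show ?thesis by blast
qed

end
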